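(* Let $p$ be a prime with $p\equiv 1\pmod 4$. Then the spectrum of $\Gamma(4,p^{4\ell})$ is determined by the spectrum of $\Gamma(4,p^4)$ for every $\ell\in\mathbb{N}$. Explicitly, let $c_1,d_1$ be integers with $p^2=c_1^2+4d_1^2$, $c_1\equiv 1\pmod 4$ and $\gcd(c_1,p)=1$, and for $\ell\in\mathbb{N}$ put $n_\ell=\frac{p^{4\ell}-1}{4}$, $$c_\ell=\tfrac12(c_1+2d_1i)^\ell+\tfrac12(c_1-2d_1i)^\ell,\qquad d_\ell=-\tfrac i4(c_1+2d_1i)^\ell+\tfrac i4(c_1-2d_1 i)^\ell.$$ Then the eigenvalues of $\Gamma(4,p^{4\ell})$, listed with multiplicity, are $n_\ell$ once and each of $$\tfrac{p^{2\ell}+4d_\ell p^\ell-1}{4},\quad \tfrac{p^{2\ell}-4d_\ell p^\ell-1}{4},\quad \tfrac{-p^{2\ell}+2c_\ell p^\ell-1}{4},\quad\tfrac{-p^{2\ell}-2c_\ell p^\ell-1}{4}$$ with multiplicity $n_\ell$.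
   Context: For a prime power $q$ and $k\mid q-1$, let $R_k=\{x^k : x\in\mathbb{F}_q^*\}$. The generalized Paley graph $\Gamma(k,q)$ is the Cayley graph on $\mathbb{F}_q$ in which $v,w$ are adjacent iff $w-v\in R_k$; its eigenvalues are those of its adjacency matrix. *)

theory Defs
  imports
    "HOL-Library.Cardinality"
    "HOL-Number_Theory.Cong"
    "Graph_Theory.Pair_Digraph"
    "Jordan_Normal_Form.Char_Poly"
begin

definition adjacency_mat :: "'v list \<Rightarrow> 'v pair_pre_digraph \<Rightarrow> complex mat" where
  "adjacency_mat vs G =
     mat (length vs) (length vs) (\<lambda>(i, j). if (vs ! i, vs ! j) \<in> parcs G then 1 else 0)"

text \<open>
  The eigenvalues of a finite digraph with algebraic multiplicity. The vertices are listed in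
  an arbitrary order; another order conjugates the adjacency matrix by a permutation matrix and
  leaves the characteristic polynomial unchanged.
\<close>
definition graph_spectrum :: "'v pair_pre_digraph \<Rightarrow> complex multiset" where
  "graph_spectrum G =
     proots (char_poly (adjacency_mat (SOME vs. distinct vs \<and> set vs = pverts G) G))"

definition cayley_digraph :: "'a::group_add set \<Rightarrow> 'a pair_pre_digraph" where
  "cayley_digraph S = \<lparr> pverts = UNIV, parcs = {(v, w). w - v \<in> S} \<rparr>"

definition nonzero_powers :: "nat \<Rightarrow> 'a::field set" where
  "nonzero_powers k = {x ^ k | x. x \<noteq> 0}"

text \<open>
  The finite field is the type: \<open>generalized_paley k\<close> over a field type with \<open>q\<close> elements is
  \<open>\<Gamma>(k,q)\<close>, which is considered for \<open>k\<close> dividing \<open>q - 1\<close>.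
\<close>
definition generalized_paley :: "nat \<Rightarrow> 'a::{field,finite} pair_pre_digraph" where
  "generalized_paley k = cayley_digraph (nonzero_powers k)"

definition c_seq :: "int \<Rightarrow> int \<Rightarrow> nat \<Rightarrow> complex" where
  "c_seq c d l = 1/2 * (of_int c + 2 * of_int d * \<i>) ^ l
               + 1/2 * (of_int c - 2 * of_int d * \<i>) ^ l"

definition d_seq :: "int \<Rightarrow> int \<Rightarrow> nat \<Rightarrow> complex" where
  "d_seq c d l = - (\<i>/4) * (of_int c + 2 * of_int d * \<i>) ^ l
               + (\<i>/4) * (of_int c - 2 * of_int d * \<i>) ^ l"

end

theory Submission
  imports Defs
begin

text \<open>
  The additive characters of \<open>F\<^sub>q\<close>, \<open>q = p\<^bsup>4l\<^esup>\<close>, diagonalize the adjacency matrix, so the eigenvalues other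
  than \<open>n\<close> are the quartic Gauss periods. With a quartic character \<open>\<chi>\<close>, these are determined by
  the Gauss sums \<open>G = G(\<chi>)\<close> and \<open>D = G(\<chi>\<^sup>2)\<close>. Here \<open>D = \<plusminus> p\<^bsup>2l\<^esup>\<close> because \<open>D\<close> is real of
  absolute value \<open>\<surd>q\<close>, and \<open>G\<^sup>2 = J D\<close> with the Jacobi sum \<open>J = J(\<chi>,\<chi>)\<close>.

  The Gaussian integer \<open>J\<close> has norm \<open>q\<close>, satisfies \<open>J \<equiv> -1\<close> modulo \<open>4\<close>, and is not divisible by \<open>p\<close>:
  modulo a prime above \<open>p\<close> it is \<open>\<plusminus> binomial(3n, n)\<close>, which is a unit since no carries occur in base \<open>p\<close>.
  These properties determine \<open>J\<close> up to conjugation, and \<open>- (c\<^sub>1 + 2 d\<^sub>1 i)\<^bsup>2l\<^esup>\<close> has them too. Put \<open>\<gamma> = G\<close> or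
  \<open>\<gamma> = i G\<close> according to the sign of \<open>D\<close>. Then \<open>\<gamma>\<^sup>2 = - p\<^bsup>2l\<^esup> J\<close>, hence
  \<open>\<gamma> = \<plusminus> p\<^sup>l (c\<^sub>1 + 2 d\<^sub>1 i)\<^sup>l\<close> up to conjugation. The multiset of eigenvalues is unchanged when \<open>\<gamma>\<close> is
  replaced by \<open>- \<gamma>\<close> or by its conjugate.

  The spectrum of \<open>\<Gamma>(4,p\<^sup>4)\<close> determines \<open>p\<close> by its size.
\<close>

section \<open>Power sums over finite fields\<close>

text \<open>Translation by 1 permutes the ring, so the sum of all elements does not change when each
  of them is increased by 1.\<close>

lemma of_nat_CARD_eq_0: "of_nat CARD('a::{comm_ring_1,finite}) = (0 :: 'a)"
proof -
  have "(\<Sum>x\<in>UNIV. x) = (\<Sum>x\<in>UNIV. x + (1 :: 'a))"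
    by (rule sum.reindex_bij_witness[of _ "\<lambda>x. x + 1" "\<lambda>x. x - 1"]) auto
  then show ?thesis
    by (simp add: sum.distrib)
qed

lemma one_less_CARD: "1 < CARD('a::{zero_neq_one,finite})"
proof -
  have "card {0, 1 :: 'a} \<le> CARD('a)"
    by (intro card_mono) auto
  then show ?thesis
    by simp
qed

lemma CHAR_eq_prime:
  assumes "prime p" and "CARD('a::{field,finite}) = p ^ L"
  shows "CHAR('a) = p"
proof -
  have "CHAR('a) > 0"
    by (intro finite_imp_CHAR_pos) simp
  then have "prime CHAR('a)"
    by (rule prime_CHAR_semidom)
  moreover have "CHAR('a) dvd p ^ L"
    using of_nat_CARD_eq_0[where 'a = 'a] unfolding assms(2) by (simp only: of_nat_eq_0_iff_char_dvd)
  ultimately show ?thesis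
    using assms(1) by (metis prime_dvd_power primes_dvd_imp_eq)
qed

lemma finite_field_power_card_minus_1:
  fixes x :: "'a::{field,finite}"
  assumes "x \<noteq> 0"
  shows "x ^ (CARD('a) - 1) = 1"
proof -
  have "(\<Prod>y\<in>UNIV - {0}. x * y) = (\<Prod>y\<in>UNIV - {0}. y)"
    by (rule prod.reindex_bij_witness[of _ "\<lambda>y. y / x" "\<lambda>y. x * y"]) (use assms in auto)
  then show ?thesis
    by (simp add: prod.distrib)
qed

lemma card_roots_of_power_eq:
  fixes c :: "'a::{field,finite}"
  assumes "k > 0"
  shows "card {x. x ^ k = c} \<le> k"
proof -
  let ?P = "monom 1 k - [:c:] :: 'a poly"
  have "coeff ?P k = 1"
    using assms by (cases k) auto
  then have "?P \<noteq> 0"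
    by (metis coeff_0 zero_neq_one)
  have "card {x. x ^ k = c} = card {x. poly ?P x = 0}"
    by (simp add: poly_monom)
  also have "\<dots> \<le> degree ?P"
    by (rule card_poly_roots_bound) fact
  also have "\<dots> \<le> k"
    by (intro degree_diff_le) (auto simp: degree_monom_le)
  finally show ?thesis .
qed

text \<open>\<open>x ^ k = 1\<close> has at most \<open>k\<close> solutions, fewer than the number
  of nonzero elements. This stands in for a generator of the multiplicative group
  throughout.\<close>

lemma exists_power_neq_1:
  assumes "0 < k" "k < CARD('a::{field,finite}) - 1"
  obtains y :: "'a::{field,finite}" where "y \<noteq> 0" "y ^ k \<noteq> 1"
proof -
  have "\<not> UNIV - {0} \<subseteq> {x :: 'a. x ^ k = 1}"
  proof
    assume "UNIV - {0} \<subseteq> {x :: 'a. x ^ k = 1}"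
    then have "card (UNIV - {0 :: 'a}) \<le> card {x :: 'a. x ^ k = 1}"
      by (intro card_mono) auto
    then show False
      using card_roots_of_power_eq[OF assms(1), of "1 :: 'a"] assms(2) by simp
  qed
  then show ?thesis
    using that by blast
qed

text \<open>Scaling the summation variable by some \<open>y\<close> with
  \<open>y ^ j \<noteq> 1\<close> multiplies the sum by \<open>y ^ j\<close> and also preserves
  it.\<close>

lemma sum_powers_eq_0:
  assumes "\<not> (CARD('a::{field,finite}) - 1) dvd j"
  shows "(\<Sum>x\<in>UNIV. (x :: 'a::{field,finite}) ^ j) = 0"
proof -
  define q where "q = CARD('a) - 1"
  have "q > 0"
    using one_less_CARD[where 'a = 'a] by (simp add: q_def)
  \<comment> \<open>Only the residue of \<open>j\<close> modulo \<open>q - 1\<close> matters; it is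
    nonzero and small enough for \<open>exists_power_neq_1\<close>. Note that \<open>q\<close>
    denotes the field size minus 1 here.\<close>
  then obtain y :: 'a where y: "y \<noteq> 0" "y ^ (j mod q) \<noteq> 1"
    using assms exists_power_neq_1[where 'a = 'a, of "j mod q"] unfolding q_def
    by (metis mod_greater_zero_iff_not_dvd mod_less_divisor)
  have "y ^ j = y ^ (q * (j div q) + j mod q)"
    by simp
  also have "\<dots> = y ^ (j mod q)"
    using finite_field_power_card_minus_1[OF y(1)]
    by (simp only: power_add power_mult flip: q_def) simp
  finally have "y ^ j \<noteq> 1"
    using y by simp
  have "(\<Sum>x\<in>UNIV. x ^ j) = (\<Sum>x\<in>UNIV. (y * x) ^ j)"
    by (rule sum.reindex_bij_witness[of _ "\<lambda>x. y * x" "\<lambda>x. x / y"]) (use y in auto)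
  also have "\<dots> = y ^ j * (\<Sum>x\<in>UNIV. x ^ j)"
    by (simp add: power_mult_distrib sum_distrib_left)
  finally show ?thesis
    using \<open>y ^ j \<noteq> 1\<close> by simp
qed

lemma sum_powers_card_minus_1:
  "(\<Sum>x\<in>UNIV. (x :: 'a::{field,finite}) ^ (CARD('a::{field,finite}) - 1)) = -1"
proof -
  have pos: "CARD('a) - 1 > 0"
    using one_less_CARD[where 'a = 'a] by simp
  have "(\<Sum>x\<in>UNIV. (x :: 'a) ^ (CARD('a) - 1)) = (\<Sum>x\<in>UNIV - {0 :: 'a}. 1)"
    by (rule sum.mono_neutral_cong_right)
      (use pos finite_field_power_card_minus_1 in \<open>auto simp: power_0_left\<close>)
  also have "\<dots> = of_nat (CARD('a) - 1)"
    by simp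
  also have "\<dots> = of_nat CARD('a) - 1"
    using pos by (subst of_nat_diff) auto
  also have "of_nat CARD('a) = (0 :: 'a)"
    by (rule of_nat_CARD_eq_0)
  finally show ?thesis
    by simp
qed

section \<open>Additive characters and the spectrum of a Cayley digraph\<close>

text \<open>Together with \<open>add\<close> and \<open>zero\<close>, the axiom \<open>cnj\<close>
  says that all values have absolute value 1.\<close>

locale additive_character =
  fixes \<psi> :: "'a::{field,finite} \<Rightarrow> complex"
  assumes add: "\<psi> (x + y) = \<psi> x * \<psi> y"
    and cnj: "cnj (\<psi> x) = \<psi> (- x)"
    and nontrivial: "\<exists>x. \<psi> x \<noteq> 1"
    and zero [simp]: "\<psi> 0 = 1"
begin

lemma sum_eq_0: "(\<Sum>x\<in>UNIV. \<psi> x) = 0"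
proof -
  obtain y where y: "\<psi> y \<noteq> 1"
    using nontrivial by blast
  have "(\<Sum>x\<in>UNIV. \<psi> x) = (\<Sum>x\<in>UNIV. \<psi> (y + x))"
    by (rule sum.reindex_bij_witness[of _ "\<lambda>x. y + x" "\<lambda>x. x - y"]) auto
  also have "\<dots> = \<psi> y * (\<Sum>x\<in>UNIV. \<psi> x)"
    by (simp add: add sum_distrib_left)
  finally show ?thesis
    using y by simp
qed

lemma sum_mult: "(\<Sum>x\<in>UNIV. \<psi> (a * x)) = (if a = 0 then of_nat CARD('a) else 0)"
proof (cases "a = 0")
  case False
  then have "(\<Sum>x\<in>UNIV. \<psi> (a * x)) = (\<Sum>x\<in>UNIV. \<psi> x)"
    by (intro sum.reindex_bij_witness[of _ "\<lambda>x. x / a" "\<lambda>x. a * x"]) auto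
  with False show ?thesis
    by (simp add: sum_eq_0)
qed simp

text \<open>The functions \<open>\<lambda>x. \<psi> (a * x)\<close> are eigenvectors. By
  orthogonality they are the columns of an invertible matrix, so the adjacency matrix is similar to
  a diagonal one and multiplicities are accounted for.\<close>

lemma graph_spectrum_cayley_digraph:
  "graph_spectrum (cayley_digraph S) = image_mset (\<lambda>a. \<Sum>s\<in>S. \<psi> (a * s)) (mset_set UNIV)"
proof -
  define vs :: "'a list" where
    "vs = (SOME vs. distinct vs \<and> set vs = pverts (cayley_digraph S))"
  have "\<exists>vs. distinct vs \<and> set vs = pverts (cayley_digraph S)"
    using finite_distinct_list[of "UNIV :: 'a set"] by (auto simp: cayley_digraph_def)
  then have "distinct vs \<and> set vs = pverts (cayley_digraph S)"
    unfolding vs_def by (rule someI_ex)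
  then have vs: "distinct vs" "set vs = UNIV"
    by (auto simp: cayley_digraph_def)
  define n where "n = length vs"
  have n: "n = CARD('a)"
    using distinct_card[OF vs(1)] vs(2) by (simp add: n_def)
  have sum_vs: "(\<Sum>k = 0..<n. f (vs ! k)) = sum f UNIV" for f :: "'a \<Rightarrow> complex"
    using vs sum.reindex_bij_betw[OF bij_betw_nth[OF vs(1), of "{0..<n}" UNIV], of f]
    by (simp add: n_def atLeast0LessThan)
  define ev where "ev a = (\<Sum>s\<in>S. \<psi> (a * s))" for a
  define M where "M = adjacency_mat vs (cayley_digraph S)"
  \<comment> \<open>\<open>V\<close> is the character table, \<open>W\<close> its conjugate
    transpose divided by \<open>n\<close>, and \<open>E\<close> the diagonal matrix of
    eigenvalues.\<close>
  define V where "V = mat n n (\<lambda>(i, j). \<psi> (vs ! i * vs ! j))"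
  define W where "W = mat n n (\<lambda>(i, j). \<psi> (- (vs ! i * vs ! j)) / of_nat n)"
  define E where "E = mat n n (\<lambda>(i, j). if i = j then ev (vs ! i) else 0)"
  have carr: "M \<in> carrier_mat n n" "V \<in> carrier_mat n n" "W \<in> carrier_mat n n" "E \<in> carrier_mat n n"
    by (auto simp: M_def V_def W_def E_def adjacency_mat_def n_def)
  have VW: "V * W = 1\<^sub>m n"
  proof (rule eq_matI)
    fix i j assume ij: "i < dim_row (1\<^sub>m n)" "j < dim_col (1\<^sub>m n)"
    then have "(V * W) $$ (i, j)
        = (\<Sum>k = 0..<n. \<psi> (vs ! i * vs ! k) * (\<psi> (- (vs ! k * vs ! j)) / of_nat n))"
      by (simp add: V_def W_def scalar_prod_def)
    also have "\<dots> = (\<Sum>x\<in>UNIV. \<psi> (vs ! i * x) * (\<psi> (- (x * vs ! j)) / of_nat n))"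
      by (rule sum_vs)
    also have "\<dots> = (\<Sum>x\<in>UNIV. \<psi> ((vs ! i - vs ! j) * x)) / of_nat n"
      by (simp add: sum_divide_distrib algebra_simps flip: add)
    also have "\<dots> = (1\<^sub>m n) $$ (i, j)"
      using ij nth_eq_iff_index_eq[OF vs(1), of i j] by (auto simp: sum_mult n n_def[symmetric])
    finally show "(V * W) $$ (i, j) = (1\<^sub>m n) $$ (i, j)" .
  qed (use carr in auto)
  then have WV: "W * V = 1\<^sub>m n"
    using carr by (metis mat_mult_left_right_inverse)
  have MV: "M * V = V * E"
  proof (rule eq_matI)
    fix i j assume "i < dim_row (V * E)" "j < dim_col (V * E)"
    then have ij: "i < n" "j < n"
      using carr by auto
    have "(M * V) $$ (i, j)
        = (\<Sum>k = 0..<n. (if vs ! k - vs ! i \<in> S then 1 else 0) * \<psi> (vs ! k * vs ! j))"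
      using ij by (simp add: M_def V_def adjacency_mat_def cayley_digraph_def scalar_prod_def n_def)
    also have "\<dots> = (\<Sum>x\<in>UNIV. (if x - vs ! i \<in> S then 1 else 0) * \<psi> (x * vs ! j))"
      by (rule sum_vs)
    also have "\<dots> = (\<Sum>x\<in>{x. x - vs ! i \<in> S}. \<psi> (x * vs ! j))"
      by (rule sum.mono_neutral_cong_right) auto
    also have "\<dots> = (\<Sum>s\<in>S. \<psi> ((s + vs ! i) * vs ! j))"
      by (rule sum.reindex_bij_witness[of _ "\<lambda>s. s + vs ! i" "\<lambda>x. x - vs ! i"]) auto
    also have "\<dots> = \<psi> (vs ! i * vs ! j) * ev (vs ! j)"
      by (simp add: ev_def distrib_left distrib_right add sum_distrib_left mult_ac)
    also have "\<dots> = (\<Sum>k = 0..<n. if k = j then \<psi> (vs ! i * vs ! k) * ev (vs ! j) else 0)"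
      using ij by simp
    also have "\<dots> = (V * E) $$ (i, j)"
      using ij by (simp add: V_def E_def scalar_prod_def if_distrib cong: if_cong)
    finally show "(M * V) $$ (i, j) = (V * E) $$ (i, j)" .
  qed (use carr in auto)
  have "M = M * (V * W)"
    using carr by (simp add: VW)
  also have "\<dots> = V * E * W"
    using carr by (simp flip: MV)
  finally have "similar_mat M E"
    using carr VW WV by (intro similar_matI[of _ _ V W n]) auto
  then have "char_poly M = char_poly E"
    by (rule char_poly_similar)
  also have "\<dots> = (\<Prod>a\<leftarrow>diag_mat E. [:- a, 1:])"
    using carr by (intro char_poly_upper_triangular) (auto simp: E_def)
  also have "diag_mat E = map ev vs"
    by (rule nth_equalityI) (auto simp: diag_mat_def E_def n_def)
  finally have "char_poly M = (\<Prod>a\<leftarrow>map ev vs. [:- a, 1:])" .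
  moreover have "proots (\<Prod>a\<leftarrow>as. [:- a, 1:]) = mset as" for as :: "complex list"
  proof (induction as)
    case (Cons a as)
    have "(\<Prod>a\<leftarrow>as. [:- a, 1:]) \<noteq> 0"
      by (auto simp: prod_list_zero_iff)
    then have "proots ([:- a, 1:] * (\<Prod>a\<leftarrow>as. [:- a, 1:])) = {#a#} + mset as"
      by (subst proots_mult) (auto simp: Cons.IH)
    then show ?case
      by simp
  qed simp
  ultimately have "proots (char_poly M) = image_mset ev (mset vs)"
    by (simp only: mset_map)
  also have "mset vs = mset_set UNIV"
    using vs by (metis mset_set_set)
  finally show ?thesis
    unfolding graph_spectrum_def M_def vs_def ev_def[abs_def] .
qed

end

text \<open>The character is \<open>exp (2 \<pi> \<i> Tr x / p)\<close> for the absolute trace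
  \<open>Tr\<close>, whose values lie in the prime field and are represented by integers below
  \<open>p\<close>.\<close>

lemma exists_additive_character:
  assumes "prime p" and card: "CARD('a::{field,finite}) = p ^ L"
  shows "\<exists>\<psi> :: 'a \<Rightarrow> complex. additive_character \<psi>"
proof -
  have char: "CHAR('a) = p"
    by (rule CHAR_eq_prime) fact+
  have p: "p > 1"
    using assms(1) by (rule prime_gt_1_nat)
  have L: "L > 0"
    using one_less_CARD[where 'a = 'a] card by (cases L) auto
  define Tr :: "'a \<Rightarrow> 'a" where "Tr x = (\<Sum>i<L. x ^ (p ^ i))" for x
  have Tr_add: "Tr (x + y) = Tr x + Tr y" for x y
  proof -
    have "(x + y) ^ (p ^ i) = x ^ (p ^ i) + y ^ (p ^ i)" for i
      by (rule freshmans_dream') (use assms(1) in \<open>simp_all add: char\<close>)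
    then show ?thesis
      by (simp add: Tr_def sum.distrib)
  qed
  have xq: "x ^ (p ^ L) = x" for x :: 'a
  proof (cases "x = 0")
    case False
    then have "x ^ CARD('a) = x"
      using power_minus_mult[of "CARD('a)" x] finite_field_power_card_minus_1[of x] by simp
    then show ?thesis
      by (simp only: card)
  qed (use p in auto)
  have "Tr x ^ p = Tr x" for x
  proof -
    have "Tr x ^ p = (\<Sum>i<L. (x ^ (p ^ i)) ^ p)"
      unfolding Tr_def by (rule freshmans_dream_sum) (use assms(1) in \<open>simp_all add: char\<close>)
    also have "\<dots> = (\<Sum>i<L. x ^ (p ^ Suc i))"
      by (simp add: mult.commute flip: power_mult)
    \<comment> \<open>Frobenius shifts the exponents by one; the new top term
      \<open>x ^ (p ^ L)\<close> equals \<open>x\<close> and replaces the lost first term.\<close>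
    also have "\<dots> = (\<Sum>i=1..<Suc L. x ^ (p ^ i))"
      by (rule sum.reindex_bij_witness[of _ "\<lambda>i. i - 1" Suc]) auto
    also have "\<dots> = Tr x"
      using L by (simp add: Tr_def xq lessThan_atLeast0 sum.atLeast_Suc_lessThan)
    finally show ?thesis .
  qed
  then have range_Tr: "Tr x \<in> {y. y ^ p = y}" for x
    by simp
  have Tr_nonzero: "\<exists>x. Tr x \<noteq> 0"
  proof (rule ccontr)
    assume *: "\<not> ?thesis"
    \<comment> \<open>The trace is a nonzero polynomial of degree at most
      \<open>p ^ (L - 1)\<close>, too small to vanish on the whole field.\<close>
    define P :: "'a poly" where "P = (\<Sum>i<L. monom 1 (p ^ i))"
    have "coeff P (p ^ (L - 1)) = (\<Sum>i<L. if i = L - 1 then 1 else 0)"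
      using p by (simp add: P_def coeff_sum)
    then have "P \<noteq> 0"
      using L by auto
    have "CARD('a) = card {x. poly P x = 0}"
      using * by (simp add: P_def Tr_def poly_sum poly_monom)
    also have "\<dots> \<le> degree P"
      by (rule card_poly_roots_bound) fact
    also have "\<dots> \<le> p ^ (L - 1)"
      unfolding P_def
      by (intro degree_sum_le order_trans[OF degree_monom_le] power_increasing) (use p in auto)
    also have "\<dots> < p ^ L"
      using p L by (intro power_strict_increasing) auto
    finally show False
      by (simp add: card)
  qed
  \<comment> \<open>The images of \<open>0, ..., p - 1\<close> are \<open>p\<close> distinct roots
    of \<open>y ^ p - y\<close>, which has no more than \<open>p\<close> roots.\<close>
  have prime_field: "{y :: 'a. y ^ p = y} = of_nat ` {..<p}"
  proof (rule sym, rule card_subset_eq)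
    have "of_nat k ^ p = (of_nat k :: 'a)" for k
    proof (induction k)
      case (Suc k)
      have "(1 + of_nat k) ^ p = 1 ^ p + (of_nat k :: 'a) ^ p"
        by (rule freshmans_dream) (use assms(1) in \<open>simp_all add: char\<close>)
      then show ?case
        using Suc by simp
    qed (use p in auto)
    then show "of_nat ` {..<p} \<subseteq> {y :: 'a. y ^ p = y}"
      by auto
    let ?P = "monom 1 p - [:0, 1:] :: 'a poly"
    have "coeff [:0, 1 :: 'a:] p = 0"
      using p by (intro coeff_eq_0) simp
    then have "coeff ?P p = 1"
      by simp
    then have "?P \<noteq> 0"
      by (metis coeff_0 zero_neq_one)
    have "card {y :: 'a. y ^ p = y} = card {x. poly ?P x = 0}"
      by (simp add: poly_monom)
    also have "\<dots> \<le> degree ?P"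
      by (rule card_poly_roots_bound) fact
    also have "\<dots> \<le> p"
      using p by (intro degree_diff_le) (auto simp: degree_monom_le)
    also have "p = card ((of_nat :: nat \<Rightarrow> 'a) ` {..<p})"
      by (subst card_image) (auto intro!: inj_onI simp: of_nat_eq_iff_cong_CHAR char cong_def)
    finally show "card ((of_nat :: nat \<Rightarrow> 'a) ` {..<p}) = card {y :: 'a. y ^ p = y}"
      using card_mono[OF _ \<open>of_nat ` {..<p} \<subseteq> {y :: 'a. y ^ p = y}\<close>] by simp
  qed simp
  have "\<exists>k<p. of_nat k = Tr x" for x
    using range_Tr[of x] prime_field by auto
  then obtain k where k: "k x < p" "of_nat (k x) = Tr x" for x
    by metis
  define \<psi> where "\<psi> x = cis (2 * pi * k x / p)" for x
  have cis_mod: "cis (2 * pi * m / p) = cis (2 * pi * (m mod p) / p)" for m :: nat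
  proof -
    have "real m = real p * real (m div p) + real (m mod p)"
      by (metis mult_div_mod_eq of_nat_add of_nat_mult)
    then have "2 * pi * m / p = 2 * pi * real (m div p) + 2 * pi * (m mod p) / p"
      using p by (simp add: field_simps)
    also have "cis \<dots> = cis (2 * pi * (m mod p) / p)"
      by (simp add: cis_multiple_2pi flip: cis_mult)
    finally show ?thesis .
  qed
  have \<psi>_add: "\<psi> (x + y) = \<psi> x * \<psi> y" for x y
  proof -
    have "of_nat (k (x + y)) = (of_nat (k x + k y) :: 'a)"
      by (simp add: k Tr_add)
    then have "[k (x + y) = k x + k y] (mod p)"
      by (simp only: of_nat_eq_iff_cong_CHAR char)
    then have "\<psi> (x + y) = cis (2 * pi * real (k x + k y) / p)"
      unfolding \<psi>_def cis_mod[of "k (x + y)"] cis_mod[of "k x + k y"] cong_def by (rule arg_cong)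
    also have "\<dots> = \<psi> x * \<psi> y"
      by (simp add: \<psi>_def cis_mult ring_distribs add_divide_distrib)
    finally show ?thesis .
  qed
  have \<psi>_nz: "\<psi> x \<noteq> 0" for x
    by (simp add: \<psi>_def)
  have \<psi>_0: "\<psi> 0 = 1"
    using \<psi>_add[of 0 0] \<psi>_nz[of 0] by simp
  have "cnj (\<psi> x) = \<psi> (- x)" for x
  proof -
    have "\<psi> x * \<psi> (- x) = 1"
      using \<psi>_add[of x "- x"] by (simp add: \<psi>_0)
    moreover have "\<psi> x * cnj (\<psi> x) = 1"
      by (simp add: \<psi>_def cis_cnj cis_mult)
    ultimately have "\<psi> x * cnj (\<psi> x) = \<psi> x * \<psi> (- x)"
      by simp
    then show ?thesis
      using \<psi>_nz by simp
  qed
  moreover have "\<exists>x. \<psi> x \<noteq> 1"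
  proof -
    obtain x where x: "Tr x \<noteq> 0"
      using Tr_nonzero by blast
    have "k x \<noteq> 0"
      using k(2)[of x] x by (metis of_nat_0)
    have "\<psi> x \<noteq> 1"
    proof
      assume "\<psi> x = 1"
      then have "cos (2 * pi * k x / p) = 1"
        by (metis \<psi>_def cis.sel(1) one_complex.sel(1))
      then obtain n :: int where "2 * pi * k x / p = of_int n * 2 * pi"
        unfolding cos_one_2pi_int by blast
      then have "real (k x) = of_int (n * int p)"
        using p by (simp add: field_simps)
      then have "int (k x) = n * int p"
        by linarith
      then have "p dvd k x"
        by (metis dvd_triv_right int_dvd_int_iff)
      then show False
        using k(1)[of x] \<open>k x \<noteq> 0\<close> by (auto dest: dvd_imp_le)
    qed
    then show ?thesis ..
  qed
  ultimately have "additive_character \<psi>"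
    by unfold_locales (auto simp: \<psi>_add \<psi>_0)
  then show ?thesis
    by blast
qed

section \<open>Gauss and Jacobi sums\<close>

text \<open>A nontrivial character of the multiplicative group with values on the unit circle,
  extended by 0.\<close>

locale multiplicative_character =
  fixes \<chi> :: "'a::{field,finite} \<Rightarrow> complex"
  assumes mult: "\<chi> (x * y) = \<chi> x * \<chi> y"
    and cnj_mult: "x \<noteq> 0 \<Longrightarrow> \<chi> x * cnj (\<chi> x) = 1"
    and zero [simp]: "\<chi> 0 = 0"
    and one [simp]: "\<chi> 1 = 1"
    and nontrivial: "\<exists>x. x \<noteq> 0 \<and> \<chi> x \<noteq> 1"
begin

lemma sum_eq_0: "(\<Sum>x\<in>UNIV. \<chi> x) = 0"
proof -
  obtain y where y: "y \<noteq> 0" "\<chi> y \<noteq> 1"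
    using nontrivial by blast
  have "(\<Sum>x\<in>UNIV. \<chi> x) = (\<Sum>x\<in>UNIV. \<chi> (y * x))"
    by (rule sum.reindex_bij_witness[of _ "\<lambda>x. y * x" "\<lambda>x. x / y"]) (use y in auto)
  also have "\<dots> = \<chi> y * (\<Sum>x\<in>UNIV. \<chi> x)"
    by (simp add: mult sum_distrib_left)
  finally show ?thesis
    using y by simp
qed

lemma sum_cnj_mult: "(\<Sum>x\<in>UNIV. \<chi> x * cnj (\<chi> x)) = of_nat CARD('a) - 1"
proof -
  have "(\<Sum>x\<in>UNIV. \<chi> x * cnj (\<chi> x)) = (\<Sum>x\<in>UNIV - {0 :: 'a}. 1)"
    by (rule sum.mono_neutral_cong_right) (auto simp: cnj_mult)
  also have "\<dots> = of_nat (CARD('a) - 1)"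
    by simp
  also have "\<dots> = of_nat CARD('a) - 1"
    using one_less_CARD[where 'a = 'a] by (subst of_nat_diff) auto
  finally show ?thesis .
qed

end

definition gauss_sum :: "('a::{field,finite} \<Rightarrow> complex) \<Rightarrow> ('a \<Rightarrow> complex) \<Rightarrow> complex" where
  "gauss_sum \<chi> \<psi> = (\<Sum>x\<in>UNIV. \<chi> x * \<psi> x)"

definition jacobi_sum :: "('a::{field,finite} \<Rightarrow> complex) \<Rightarrow> complex" where
  "jacobi_sum \<chi> = (\<Sum>x\<in>UNIV. \<chi> x * \<chi> (1 - x))"

locale gauss_sum_characters = additive_character \<psi> + mult: multiplicative_character \<chi>
  for \<psi> \<chi> :: "'a::{field,finite} \<Rightarrow> complex"
begin

text \<open>Substitute \<open>a * x\<close> for \<open>x\<close>; the inverse of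
  \<open>\<chi> a\<close> is its conjugate.\<close>

lemma gauss_sum_twist:
  assumes "a \<noteq> 0"
  shows "(\<Sum>x\<in>UNIV. \<chi> x * \<psi> (a * x)) = cnj (\<chi> a) * gauss_sum \<chi> \<psi>"
proof -
  have "cnj (\<chi> a) * gauss_sum \<chi> \<psi> = (\<Sum>x\<in>UNIV. cnj (\<chi> a) * (\<chi> (a * x) * \<psi> (a * x)))"
    unfolding gauss_sum_def sum_distrib_left
    by (rule sum.reindex_bij_witness[of _ "\<lambda>x. a * x" "\<lambda>x. x / a"]) (use assms in auto)
  also have "\<dots> = (\<Sum>x\<in>UNIV. (\<chi> a * cnj (\<chi> a)) * (\<chi> x * \<psi> (a * x)))"
    by (simp add: mult.mult mult_ac)
  also have "\<dots> = (\<Sum>x\<in>UNIV. \<chi> x * \<psi> (a * x))"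
    by (simp only: mult.cnj_mult[OF assms] mult_1)
  finally show ?thesis ..
qed

text \<open>Parseval for the finite Fourier transform of \<open>\<chi>\<close>.\<close>
lemma gauss_sum_mult_cnj: "gauss_sum \<chi> \<psi> * cnj (gauss_sum \<chi> \<psi>) = of_nat CARD('a)"
proof -
  define q where "q = CARD('a)"
  have q: "q > 1"
    unfolding q_def by (rule one_less_CARD)
  define F where "F a = (\<Sum>x\<in>UNIV. \<chi> x * \<psi> (a * x))" for a
  have "\<chi> x * \<psi> (a * x) * (cnj (\<chi> y) * \<psi> (- (a * y)))
      = (\<chi> x * cnj (\<chi> y)) * \<psi> ((x - y) * a)" for a x y
  proof -
    have eq: "(x - y) * a = a * x + - (a * y)"
      by (simp add: algebra_simps)
    show ?thesis
      unfolding eq add by (simp only: mult_ac)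
  qed
  then have "(\<Sum>a\<in>UNIV. F a * cnj (F a))
      = (\<Sum>a\<in>UNIV. \<Sum>x\<in>UNIV. \<Sum>y\<in>UNIV. (\<chi> x * cnj (\<chi> y)) * \<psi> ((x - y) * a))"
    by (simp only: F_def sum_product cnj complex_cnj_mult cnj_sum)
  also have "\<dots> = (\<Sum>x\<in>UNIV. \<Sum>y\<in>UNIV. (\<chi> x * cnj (\<chi> y)) * (\<Sum>a\<in>UNIV. \<psi> ((x - y) * a)))"
    by (subst sum.swap, rule sum.cong[OF refl], subst sum.swap) (simp add: sum_distrib_left)
  also have "\<dots> = (\<Sum>x\<in>UNIV. \<chi> x * cnj (\<chi> x) * of_nat q)"
    by (simp add: sum_mult q_def if_distrib cong: if_cong)
  also have "\<dots> = (of_nat q - 1) * of_nat q"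
    by (simp add: mult.sum_cnj_mult q_def flip: sum_distrib_right)
  finally have 1: "(\<Sum>a\<in>UNIV. F a * cnj (F a)) = (of_nat q - 1) * of_nat q" .
  \<comment> \<open>Each of the \<open>q - 1\<close> nonzero frequencies contributes the same
    amount, and frequency 0 contributes nothing.\<close>
  have F: "F a * cnj (F a) = gauss_sum \<chi> \<psi> * cnj (gauss_sum \<chi> \<psi>)" if "a \<noteq> 0" for a
  proof -
    have "F a * cnj (F a) = (\<chi> a * cnj (\<chi> a)) * (gauss_sum \<chi> \<psi> * cnj (gauss_sum \<chi> \<psi>))"
      unfolding F_def gauss_sum_twist[OF that] by simp
    then show ?thesis
      by (simp only: mult.cnj_mult[OF that] mult_1)
  qed
  have "F 0 = 0"
    by (simp add: F_def mult.sum_eq_0)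
  then have "(\<Sum>a\<in>UNIV. F a * cnj (F a))
      = (\<Sum>a\<in>UNIV - {0 :: 'a}. gauss_sum \<chi> \<psi> * cnj (gauss_sum \<chi> \<psi>))"
    by (intro sum.mono_neutral_cong_right) (auto simp: F)
  also have "\<dots> = of_nat (q - 1) * (gauss_sum \<chi> \<psi> * cnj (gauss_sum \<chi> \<psi>))"
    by (simp add: q_def)
  also have "of_nat (q - 1) = (of_nat q - 1 :: complex)"
    using q by (subst of_nat_diff) auto
  finally have 2: "(\<Sum>a\<in>UNIV. F a * cnj (F a))
      = (of_nat q - 1) * (gauss_sum \<chi> \<psi> * cnj (gauss_sum \<chi> \<psi>))" .
  have "of_nat q - 1 \<noteq> (0 :: complex)"
    using q by simp
  then show ?thesis
    using 1 2 by (simp add: q_def)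
qed

text \<open>Collect the double sum by \<open>s = x + y\<close>. The inner convolution is
  \<open>\<chi> s ^ 2\<close> times the Jacobi sum: by scaling for nonzero \<open>s\<close>, and
  because the sum of \<open>\<chi>\<^sup>2\<close> vanishes for \<open>s = 0\<close>.\<close>

lemma gauss_sum_square:
  assumes "multiplicative_character (\<lambda>x. \<chi> x ^ 2)" and "\<chi> (-1) ^ 2 = 1"
  shows "gauss_sum \<chi> \<psi> ^ 2 = jacobi_sum \<chi> * gauss_sum (\<lambda>x. \<chi> x ^ 2) \<psi>"
proof -
  interpret sq: multiplicative_character "\<lambda>x. \<chi> x ^ 2" by fact
  define f where "f s = (\<Sum>x\<in>UNIV. \<chi> x * \<chi> (s - x))" for s
  have f: "f s = \<chi> s ^ 2 * jacobi_sum \<chi>" for s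
  proof (cases "s = 0")
    case True
    have "\<chi> x * \<chi> (- x) = \<chi> (-1) * \<chi> x ^ 2" for x
      using mult.mult[of "-1" x] by (simp add: power2_eq_square)
    with True have "f s = \<chi> (-1) * (\<Sum>x\<in>UNIV. \<chi> x ^ 2)"
      by (simp add: f_def sum_distrib_left)
    then show ?thesis
      using True by (simp add: sq.sum_eq_0)
  next
    case False
    then have "f s = (\<Sum>x\<in>UNIV. \<chi> (s * x) * \<chi> (s - s * x))"
      unfolding f_def
      by (intro sum.reindex_bij_witness[of _ "\<lambda>x. s * x" "\<lambda>x. x / s"]) auto
    also have "\<dots> = (\<Sum>x\<in>UNIV. \<chi> s ^ 2 * (\<chi> x * \<chi> (1 - x)))"
    proof (rule sum.cong[OF refl])
      fix x
      have "s - s * x = s * (1 - x)"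
        by (simp add: algebra_simps)
      then show "\<chi> (s * x) * \<chi> (s - s * x) = \<chi> s ^ 2 * (\<chi> x * \<chi> (1 - x))"
        by (simp add: mult.mult power2_eq_square mult_ac)
    qed
    finally show ?thesis
      by (simp add: jacobi_sum_def sum_distrib_left)
  qed
  have "gauss_sum \<chi> \<psi> ^ 2 = (\<Sum>x\<in>UNIV. \<Sum>y\<in>UNIV. \<chi> x * \<chi> y * \<psi> (x + y))"
    by (simp add: gauss_sum_def power2_eq_square sum_product add mult_ac)
  also have "\<dots> = (\<Sum>x\<in>UNIV. \<Sum>s\<in>UNIV. \<chi> x * \<chi> (s - x) * \<psi> s)"
  proof (rule sum.cong[OF refl])
    fix x
    show "(\<Sum>y\<in>UNIV. \<chi> x * \<chi> y * \<psi> (x + y)) = (\<Sum>s\<in>UNIV. \<chi> x * \<chi> (s - x) * \<psi> s)"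
      by (rule sum.reindex_bij_witness[of _ "\<lambda>s. s - x" "\<lambda>y. x + y"]) auto
  qed
  also have "\<dots> = (\<Sum>s\<in>UNIV. f s * \<psi> s)"
    by (subst sum.swap) (simp add: f_def sum_distrib_right)
  finally show ?thesis
    by (simp add: f gauss_sum_def sum_distrib_left mult_ac)
qed

end

section \<open>Binomial coefficients and sums of two squares\<close>

text \<open>The multiples of \<open>p\<close> among the factors are \<open>p, 2 p, ..., n p\<close>,
  with product \<open>p ^ n * fact n\<close>; the others multiply to \<open>u\<close>.\<close>

lemma fact_prime_mult_add:
  assumes "prime p"
  shows "r < p \<Longrightarrow> \<exists>u :: nat. \<not> p dvd u \<and> fact (p * n + r) = p ^ n * fact n * u"
proof (induction n arbitrary: r)
  case 0
  then show ?case
    using assms by (auto simp: prime_dvd_fact_iff)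
next
  case (Suc n)
  have p: "p > 1"
    using assms by (rule prime_gt_1_nat)
  from Suc.prems show ?case
  proof (induction r)
    case 0
    from Suc.IH[of "p - 1"] p obtain u
      where u: "\<not> p dvd u" "fact (p * n + (p - 1)) = p ^ n * fact n * u"
      by auto
    have "p * Suc n = Suc (p * n + (p - 1))"
      using p by simp
    then have "fact (p * Suc n) = p * Suc n * fact (p * n + (p - 1))"
      by (metis fact_Suc of_nat_id)
    also have "\<dots> = p ^ Suc n * fact (Suc n) * u"
      unfolding u by (simp add: algebra_simps)
    finally show ?case
      using u by auto
  next
    case (Suc r)
    then obtain u where u: "\<not> p dvd u" "fact (p * Suc n + r) = p ^ Suc n * fact (Suc n) * u"
      by auto
    have "fact (p * Suc n + Suc r) = (p * Suc n + Suc r) * fact (p * Suc n + r)"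
      by (metis add_Suc_right fact_Suc of_nat_id)
    also have "\<dots> = p ^ Suc n * fact (Suc n) * ((p * Suc n + Suc r) * u)"
      by (simp only: u mult_ac)
    finally have "fact (p * Suc n + Suc r) = p ^ Suc n * fact (Suc n) * ((p * Suc n + Suc r) * u)" .
    moreover have "p dvd p * Suc n + Suc r \<longleftrightarrow> p dvd Suc r"
      by (rule dvd_add_right_iff) simp
    then have "\<not> p dvd p * Suc n + Suc r"
      using Suc.prems by (auto dest: dvd_imp_le)
    ultimately show ?case
      using u assms by (metis prime_dvd_mult_iff)
  qed
qed

text \<open>No carry occurs when adding \<open>m\<close> and \<open>2 m\<close> in base \<open>p\<close>: all digits of \<open>m\<close> are \<open>(p - 1) / 4\<close>.\<close>
lemma prime_not_dvd_choose:
  assumes "prime p" "[p = 1] (mod 4)" "4 * m + 1 = p ^ L"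
  shows "\<not> p dvd ((3 * m) choose m)"
  using assms(3)
proof (induction L arbitrary: m)
  case 0
  then show ?case
    using prime_gt_1_nat[OF assms(1)] by simp
next
  case (Suc L m')
  have p: "p > 1"
    using assms(1) by (rule prime_gt_1_nat)
  have "[p ^ L = 1 ^ L] (mod 4)"
    using assms(2) by (rule cong_pow)
  then have "p ^ L mod 4 = 1" "p mod 4 = 1"
    using assms(2) by (simp_all add: cong_def)
  then obtain m t where m: "4 * m + 1 = p ^ L" and t: "p = 4 * t + 1"
    by (metis mult_div_mod_eq)
  have "4 * m' + 1 = p * (4 * m + 1)"
    using Suc.prems m by simp
  \<comment> \<open>\<open>t = (p - 1) / 4\<close> is the last base-\<open>p\<close> digit. Since
    \<open>t\<close>, \<open>2 * t\<close> and \<open>3 * t\<close> are below \<open>p\<close>, the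
    factorial lemma applies to all three factorials.\<close>
  then have m': "m' = p * m + t"
    unfolding t by (simp add: algebra_simps)
  obtain u1 where u1: "\<not> p dvd u1" "fact m' = p ^ m * fact m * u1"
    using fact_prime_mult_add[OF assms(1), of t m] t m' by auto
  obtain u2 where u2: "\<not> p dvd u2" "fact (2 * m') = p ^ (2 * m) * fact (2 * m) * u2"
    using fact_prime_mult_add[OF assms(1), of "2 * t" "2 * m"] t m' by (auto simp: algebra_simps)
  obtain u3 where u3: "\<not> p dvd u3" "fact (3 * m') = p ^ (3 * m) * fact (3 * m) * u3"
    using fact_prime_mult_add[OF assms(1), of "3 * t" "3 * m"] t m' by (auto simp: algebra_simps)
  have choose: "fact k * fact (2 * k) * (3 * k choose k) = (fact (3 * k) :: nat)" for k
    using binomial_fact_lemma[of k "3 * k"] by simp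
  define K where "K = p ^ (3 * m) * fact m * (fact (2 * m) :: nat)"
  have K: "K \<noteq> 0"
    using p by (simp add: K_def)
  have "p ^ (3 * m) = p ^ m * p ^ (2 * m)"
    by (simp flip: power_add)
  then have "K * (u1 * u2 * (3 * m' choose m')) = fact m' * fact (2 * m') * (3 * m' choose m')"
    by (simp add: K_def u1 u2)
  also have "\<dots> = p ^ (3 * m) * (fact m * fact (2 * m) * (3 * m choose m)) * u3"
    by (simp only: choose u3)
  also have "\<dots> = K * ((3 * m choose m) * u3)"
    by (simp add: K_def)
  finally have "u1 * u2 * (3 * m' choose m') = (3 * m choose m) * u3"
    using K by simp
  moreover have "\<not> p dvd (3 * m choose m) * u3"
    using Suc.IH[OF m] u3 assms(1) by (simp add: prime_dvd_mult_iff)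
  ultimately show ?case
    by (metis dvd_mult)
qed

text \<open>
  Brahmagupta's identity bounds \<open>\<bar>a * B - A * b\<bar>\<close> and \<open>\<bar>a * B + A * b\<bar>\<close> by \<open>N = p ^ k\<close>, and their
  product is a multiple of \<open>N\<close>. Coprimality and parity force one of them to vanish.
\<close>
lemma sum_of_two_squares_unique:
  fixes a b A B :: int
  assumes "prime p" "odd p"
    and N: "a\<^sup>2 + b\<^sup>2 = int p ^ k" "A\<^sup>2 + B\<^sup>2 = int p ^ k"
    and "\<not> int p dvd a" "\<not> int p dvd A" "even b" "even B" "k > 0"
  shows "a\<^sup>2 = A\<^sup>2 \<and> b\<^sup>2 = B\<^sup>2"
proof -
  have p: "prime (int p)"
    using assms(1) by simp
  have "\<not> int p dvd B"
  proof
    assume "int p dvd B"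
    then have "int p dvd int p ^ k - B * B"
      using \<open>k > 0\<close> by (intro dvd_diff dvd_power dvd_mult) auto
    also have "int p ^ k - B * B = A * A"
      using N by (simp add: power2_eq_square)
    finally show False
      using p assms(6) by (simp add: prime_dvd_mult_iff)
  qed
  have prod: "(a * B - A * b) * (a * B + A * b) = int p ^ k * (a\<^sup>2 - A\<^sup>2)"
  proof -
    have "(a * B - A * b) * (a * B + A * b) = a\<^sup>2 * (A\<^sup>2 + B\<^sup>2) - A\<^sup>2 * (a\<^sup>2 + b\<^sup>2)"
      by (simp add: algebra_simps power2_eq_square)
    then show ?thesis
      unfolding N by (simp add: algebra_simps)
  qed
  \<comment> \<open>The quotient of \<open>X\<close> by the odd number \<open>p ^ k\<close> is even
    and has absolute value at most 1.\<close>
  have vanish: "X = 0" if "int p ^ k dvd X" "even X" "X\<^sup>2 + Y\<^sup>2 = (int p ^ k)\<^sup>2" for X Y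
  proof (rule ccontr)
    assume "X \<noteq> 0"
    from that(1) obtain c where c: "X = int p ^ k * c" ..
    have "int p ^ k \<noteq> 0"
      using p by auto
    have "(int p ^ k)\<^sup>2 * c\<^sup>2 \<le> (int p ^ k)\<^sup>2 * 1"
      using that(3) zero_le_power2[of Y] unfolding c power_mult_distrib by linarith
    then have "c\<^sup>2 \<le> 1"
      by (rule mult_left_le_imp_le) (use \<open>int p ^ k \<noteq> 0\<close> in simp)
    then have "\<bar>c\<bar> \<le> 1"
      by (simp add: abs_square_le_1)
    moreover have "c \<noteq> 0" "even c"
      using \<open>X \<noteq> 0\<close> that(2) \<open>odd p\<close> by (auto simp: c)
    ultimately show False
      by (auto elim!: evenE)
  qed
  have "(a * B - A * b)\<^sup>2 + (a * A + b * B)\<^sup>2 = (a\<^sup>2 + b\<^sup>2) * (A\<^sup>2 + B\<^sup>2)"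
       "(a * B + A * b)\<^sup>2 + (a * A - b * B)\<^sup>2 = (a\<^sup>2 + b\<^sup>2) * (A\<^sup>2 + B\<^sup>2)"
    by (simp_all add: algebra_simps power2_eq_square)
  then have norms: "(a * B - A * b)\<^sup>2 + (a * A + b * B)\<^sup>2 = (int p ^ k)\<^sup>2"
       "(a * B + A * b)\<^sup>2 + (a * A - b * B)\<^sup>2 = (int p ^ k)\<^sup>2"
    unfolding N by (simp_all add: power2_eq_square)
  have cop: "int p ^ k dvd Y" if "\<not> int p dvd X" "int p ^ k dvd X * Y" for X Y
    using that p by (metis coprime_dvd_mult_right_iff coprime_power_left_iff prime_imp_coprime)
  \<comment> \<open>Otherwise \<open>p\<close> would divide the sum
    \<open>2 * a * B\<close>.\<close>
  have "\<not> int p dvd a * B - A * b \<or> \<not> int p dvd a * B + A * b"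
  proof (rule ccontr)
    assume "\<not> ?thesis"
    then have "int p dvd a * B - A * b" "int p dvd a * B + A * b"
      by simp_all
    then have "int p dvd (a * B - A * b) + (a * B + A * b)"
      by (rule dvd_add)
    then have "int p dvd 2 * (a * B)"
      by (simp add: mult_ac)
    then have "int p dvd 2"
      using p \<open>\<not> int p dvd B\<close> assms(5) by (simp add: prime_dvd_mult_iff)
    then have "p dvd 2"
      by presburger
    then show False
      using \<open>odd p\<close> assms(1) by (metis primes_dvd_imp_eq two_is_prime_nat even_numeral dvd_refl)
  qed
  then have "int p ^ k dvd a * B + A * b \<or> int p ^ k dvd a * B - A * b"
    using cop[of "a * B - A * b" "a * B + A * b"] cop[of "a * B + A * b" "a * B - A * b"] prod
    by (auto simp: mult.commute)
  then have "a * B + A * b = 0 \<or> a * B - A * b = 0"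
    using vanish[OF _ _ norms(1)] vanish[OF _ _ norms(2)] \<open>even b\<close> \<open>even B\<close> by auto
  then have "int p ^ k * (a\<^sup>2 - A\<^sup>2) = 0"
    using prod by auto
  then have "a\<^sup>2 = A\<^sup>2"
    using p by auto
  then show ?thesis
    using N by simp
qed

section \<open>Gaussian integers\<close>

text \<open>
  The Gaussian integer \<open>z\<close> is sent to \<open>w\<close> by the ring homomorphism \<open>\<i> \<mapsto> e\<close>, where \<open>e\<^sup>2 = -1\<close>.
\<close>
definition gauss_red :: "'a::comm_ring_1 \<Rightarrow> complex \<Rightarrow> 'a \<Rightarrow> bool" where
  "gauss_red e z w \<longleftrightarrow> (\<exists>a b. z = of_int a + of_int b * \<i> \<and> w = of_int a + of_int b * e)"

lemma gauss_red_of_int: "gauss_red e (of_int a) (of_int a)"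
  unfolding gauss_red_def by (rule exI[of _ a], rule exI[of _ 0]) simp

lemma gauss_red_0: "gauss_red e 0 0" and gauss_red_1: "gauss_red e 1 1"
  using gauss_red_of_int[of e 0] gauss_red_of_int[of e 1] by simp_all

lemma gauss_red_imaginary_unit: "gauss_red e \<i> e"
  unfolding gauss_red_def by (rule exI[of _ 0], rule exI[of _ 1]) simp

lemma gauss_red_add:
  assumes "gauss_red e z w" "gauss_red e z' w'"
  shows "gauss_red e (z + z') (w + w')"
proof -
  obtain a b a' b' where "z = of_int a + of_int b * \<i>" "w = of_int a + of_int b * e"
      "z' = of_int a' + of_int b' * \<i>" "w' = of_int a' + of_int b' * e"
    using assms unfolding gauss_red_def by blast
  then show ?thesis
    unfolding gauss_red_def
    by (intro exI[of _ "a + a'"] exI[of _ "b + b'"]) (simp add: algebra_simps)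
qed

lemma gauss_red_mult:
  assumes "e\<^sup>2 = -1" "gauss_red e z w" "gauss_red e z' w'"
  shows "gauss_red e (z * z') (w * w')"
proof -
  obtain a b a' b' where *: "z = of_int a + of_int b * \<i>" "w = of_int a + of_int b * e"
      "z' = of_int a' + of_int b' * \<i>" "w' = of_int a' + of_int b' * e"
    using assms unfolding gauss_red_def by blast
  have "w * w' = of_int a * of_int a' + of_int b * of_int b' * e\<^sup>2 + (of_int a * of_int b' + of_int b * of_int a') * e"
    unfolding * power2_eq_square by (simp add: algebra_simps)
  then have "w * w' = of_int (a * a' - b * b') + of_int (a * b' + b * a') * e"
    by (simp add: assms(1))
  moreover have "z * z' = of_int (a * a' - b * b') + of_int (a * b' + b * a') * \<i>"
    unfolding * by (simp add: algebra_simps complex_eq_iff)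
  ultimately show ?thesis
    unfolding gauss_red_def by blast
qed

lemma gauss_red_power:
  assumes "e\<^sup>2 = -1" "gauss_red e z w"
  shows "gauss_red e (z ^ n) (w ^ n)"
  using assms by (induction n) (auto intro: gauss_red_mult gauss_red_1)

lemma gauss_red_sum:
  "(\<And>x. x \<in> A \<Longrightarrow> gauss_red e (f x) (g x)) \<Longrightarrow> gauss_red e (sum f A) (sum g A)"
  by (induction A rule: infinite_finite_induct) (auto intro: gauss_red_add gauss_red_0)

text \<open>With \<open>e = \<i>\<close> the reduction is the identity, so the relation becomes
  membership in the Gaussian integers.\<close>

abbreviation gauss_int :: "complex \<Rightarrow> bool" where
  "gauss_int z \<equiv> gauss_red \<i> z z"

text \<open>Outside characteristic 2 such an \<open>e\<close> has order exactly 4. Applied to both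
  \<open>\<iota>\<close> and \<open>\<i>\<close>, this identifies fourth roots of unity in the
  finite field with those in the complex numbers.\<close>

lemma sqrt_minus_1_power_eq_iff:
  fixes e :: "'a::field"
  assumes e: "e\<^sup>2 = -1" and "(2 :: 'a) \<noteq> 0"
  shows "e ^ j = e ^ k \<longleftrightarrow> [j = k] (mod 4)"
proof -
  have e4: "e ^ 4 = 1"
    using power_mult[of e 2 2] e by simp
  have red: "e ^ n = e ^ (n mod 4)" for n
  proof -
    have "e ^ n = e ^ (4 * (n div 4) + n mod 4)"
      by simp
    also have "\<dots> = e ^ (n mod 4)"
      by (simp only: power_add power_mult e4 power_one mult_1)
    finally show ?thesis .
  qed
  have "e ^ 3 = - e"
    using e by (simp add: eval_nat_numeral)
  have 1: "(1 :: 'a) \<noteq> -1"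
    using assms(2) by (metis add.right_inverse one_add_one)
  have "e \<noteq> 0"
    using e by auto
  then have 2: "e \<noteq> - e"
    using assms(2) by (metis add.right_inverse mult_2 mult_eq_0_iff)
  have 3: "e \<noteq> 1" "e \<noteq> -1"
    using e 1 by auto
  have "n mod 4 \<in> {0, 1, 2, 3}" for n :: nat
    by auto
  from this[of j] this[of k] have "e ^ (j mod 4) = e ^ (k mod 4) \<longleftrightarrow> j mod 4 = k mod 4"
    using 1 2 3 e \<open>e ^ 3 = - e\<close> \<open>e \<noteq> 0\<close> by (auto simp: minus_equation_iff)
  then show ?thesis
    unfolding cong_def by (metis red)
qed

text \<open>\<open>B\<close> takes one point from each two-element orbit of \<open>\<sigma>\<close>.
  This yields a factor 2 in the congruence for the Jacobi sum.\<close>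

lemma sum_involution:
  fixes f :: "'a \<Rightarrow> 'b::comm_ring_1"
  assumes "finite A" "\<And>x. x \<in> A \<Longrightarrow> \<sigma> x \<in> A \<and> \<sigma> (\<sigma> x) = x \<and> \<sigma> x \<noteq> x \<and> f (\<sigma> x) = f x"
  shows "\<exists>B\<subseteq>A. sum f A = 2 * sum f B"
  using assms
proof (induction "card A" arbitrary: A rule: less_induct)
  case less
  show ?case
  proof (cases "A = {}")
    case False
    then obtain x where x: "x \<in> A"
      by blast
    define A' where "A' = A - {x, \<sigma> x}"
    have sx: "\<sigma> x \<in> A" "\<sigma> (\<sigma> x) = x" "\<sigma> x \<noteq> x" "f (\<sigma> x) = f x"
      using less.prems(2)[OF x] by auto
    have "card A' < card A"
      unfolding A'_def by (rule psubset_card_mono) (use x less.prems in auto)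
    moreover have "\<sigma> y \<in> A' \<and> \<sigma> (\<sigma> y) = y \<and> \<sigma> y \<noteq> y \<and> f (\<sigma> y) = f y" if "y \<in> A'" for y
      using less.prems(2)[of y] that sx unfolding A'_def by (metis Diff_iff insert_iff empty_iff)
    ultimately obtain B where B: "B \<subseteq> A'" "sum f A' = 2 * sum f B"
      using less.hyps[of A'] less.prems(1) by (auto simp: A'_def)
    have "A = insert x (insert (\<sigma> x) A')" "x \<notin> A'" "\<sigma> x \<notin> A'" "finite A'"
      using x sx less.prems(1) by (auto simp: A'_def)
    then have "sum f A = f x + (f (\<sigma> x) + sum f A')"
      using sx by (metis finite_insert insert_iff sum.insert)
    moreover have "sum f (insert x B) = f x + sum f B"
      using B less.prems(1) finite_subset[of B A] by (subst sum.insert) (auto simp: A'_def)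
    ultimately have "sum f A = 2 * sum f (insert x B)"
      by (simp add: B sx algebra_simps)
    then show ?thesis
      using B x by (intro exI[of _ "insert x B"]) (auto simp: A'_def)
  qed auto
qed

section \<open>The quartic Jacobi sum\<close>

text \<open>If \<open>x ^ (4 * m) = 1\<close> but \<open>x ^ (2 * m) \<noteq> 1\<close>, then
  \<open>x ^ (2 * m) = -1\<close>.\<close>

lemma exists_sqrt_minus_1:
  assumes "CARD('a::{field,finite}) = 4 * m + 1"
  shows "\<exists>\<iota> :: 'a. \<iota>\<^sup>2 = -1"
proof -
  have "m > 0"
    using assms one_less_CARD[where 'a = 'a] by simp
  then obtain x :: 'a where x: "x \<noteq> 0" "x ^ (2 * m) \<noteq> 1"
    using exists_power_neq_1[where 'a = 'a, of "2 * m"] assms by auto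
  have "x ^ (4 * m) = 1"
    using finite_field_power_card_minus_1[OF x(1)] assms by simp
  then have "(x ^ (2 * m) - 1) * ((x ^ m)\<^sup>2 + 1) = 0"
    by (simp add: algebra_simps flip: power_mult power_add)
  then have "(x ^ m)\<^sup>2 = -1"
    using x by (simp add: eq_neg_iff_add_eq_0)
  then show ?thesis ..
qed

text \<open>\<open>m\<close> is \<open>(q - 1) / 4\<close>, and \<open>4 dvd m\<close> means
  \<open>q \<equiv> 1\<close> modulo 16. Hence the quartic character is 1 at both \<open>-1\<close>
  and \<open>\<iota>\<close>.\<close>

locale quartic_field =
  fixes \<iota> :: "'a::{field,finite}" and m :: nat
  assumes card: "CARD('a) = 4 * m + 1" and m4: "4 dvd m" and \<iota>: "\<iota>\<^sup>2 = -1"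
begin

lemma m_pos: "m > 0"
  using card one_less_CARD[where 'a = 'a] by simp

lemma two_neq_0: "(2 :: 'a) \<noteq> 0"
proof
  assume "(2 :: 'a) = 0"
  then have "(of_nat (2 * (2 * m) + 1) :: 'a) = 1"
    by (simp only: of_nat_add of_nat_mult of_nat_numeral mult_zero_left add_0 of_nat_1)
  moreover have "2 * (2 * m) + 1 = CARD('a)"
    using card by simp
  ultimately show False
    using of_nat_CARD_eq_0[where 'a = 'a] by (simp only: zero_neq_one)
qed

lemmas \<iota>_power_eq_iff = sqrt_minus_1_power_eq_iff[OF \<iota> two_neq_0]

lemma imaginary_unit_power_eq_iff: "\<i> ^ j = \<i> ^ k \<longleftrightarrow> [j = k] (mod 4)"
  by (rule sqrt_minus_1_power_eq_iff) auto

lemma power_4m: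
  fixes x :: 'a
  assumes "x \<noteq> 0"
  shows "(x ^ m) ^ 4 = 1"
  using finite_field_power_card_minus_1[OF assms] card by (simp add: mult.commute flip: power_mult)

text \<open>The fourth root of unity \<open>x ^ m\<close> is carried to the complex numbers by
  \<open>\<iota> \<mapsto> \<i>\<close>. The chosen exponent matters only modulo 4.\<close>

definition \<chi> :: "'a \<Rightarrow> complex" where
  "\<chi> x = (if x = 0 then 0 else \<i> ^ (SOME k. x ^ m = \<iota> ^ k))"

lemma \<chi>_eqI:
  assumes "x \<noteq> 0" "x ^ m = \<iota> ^ k"
  shows "\<chi> x = \<i> ^ k"
proof -
  have "x ^ m = \<iota> ^ (SOME k. x ^ m = \<iota> ^ k)"
    using assms(2) by (rule someI)
  then have "[(SOME k. x ^ m = \<iota> ^ k) = k] (mod 4)"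
    using assms(2) \<iota>_power_eq_iff by metis
  then show ?thesis
    using assms(1) by (simp add: \<chi>_def imaginary_unit_power_eq_iff)
qed

lemma \<chi>_cases:
  assumes "x \<noteq> 0"
  obtains k where "k < 4" "x ^ m = \<iota> ^ k" "\<chi> x = \<i> ^ k"
proof -
  define y where "y = x ^ m"
  have \<iota>3: "\<iota> ^ 3 = - \<iota>"
    using \<iota> by (simp add: eval_nat_numeral)
  have "(y - 1) * (y + 1) * ((y - \<iota>) * (y + \<iota>)) = (y\<^sup>2 - 1) * (y\<^sup>2 - \<iota>\<^sup>2)"
    by (simp add: algebra_simps power2_eq_square)
  also have "\<dots> = y ^ 4 - 1"
    by (simp add: \<iota> algebra_simps flip: power_add)
  also have "\<dots> = 0"
    using power_4m[OF assms] by (simp add: y_def)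
  finally have "y = 1 \<or> y = -1 \<or> y = \<iota> \<or> y = - \<iota>"
    by (auto simp: eq_neg_iff_add_eq_0)
  then have "y = \<iota> ^ 0 \<or> y = \<iota> ^ 2 \<or> y = \<iota> ^ 1 \<or> y = \<iota> ^ 3"
    by (simp only: \<iota> \<iota>3 power_0 power_one_right)
  then have "\<exists>k\<in>{0, 2, 1, 3}. y = \<iota> ^ k"
    by blast
  then obtain k where "k \<in> {0, 2, 1, 3}" "y = \<iota> ^ k" ..
  then have k: "k < 4" "x ^ m = \<iota> ^ k"
    by (force, simp only: y_def)
  show ?thesis
    using that[OF k \<chi>_eqI[OF assms k(2)]] .
qed

lemma \<chi>_0 [simp]: "\<chi> 0 = 0"
  by (simp add: \<chi>_def)

lemma \<chi>_1 [simp]: "\<chi> 1 = 1"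
  using \<chi>_eqI[of 1 0] by simp

lemma \<chi>_mult: "\<chi> (x * y) = \<chi> x * \<chi> y"
proof (cases "x = 0 \<or> y = 0")
  case False
  then obtain j k where "x ^ m = \<iota> ^ j" "\<chi> x = \<i> ^ j" "y ^ m = \<iota> ^ k" "\<chi> y = \<i> ^ k"
    by (metis \<chi>_cases)
  then show ?thesis
    using False \<chi>_eqI[of "x * y" "j + k"] by (simp add: power_mult_distrib power_add)
qed auto

lemma \<chi>_eq_1_iff:
  assumes "x \<noteq> 0"
  shows "\<chi> x ^ n = 1 \<longleftrightarrow> x ^ (m * n) = 1"
proof -
  obtain k where k: "x ^ m = \<iota> ^ k" "\<chi> x = \<i> ^ k"
    using assms by (metis \<chi>_cases)
  have "\<chi> x ^ n = 1 \<longleftrightarrow> \<i> ^ (k * n) = \<i> ^ 0"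
    by (simp add: k power_mult)
  also have "\<dots> \<longleftrightarrow> \<iota> ^ (k * n) = \<iota> ^ 0"
    unfolding imaginary_unit_power_eq_iff \<iota>_power_eq_iff ..
  finally show ?thesis
    by (simp add: k power_mult)
qed

lemma multiplicative_character_\<chi>_power:
  assumes "n > 0" "n < 4"
  shows "multiplicative_character (\<lambda>x. \<chi> x ^ n)"
proof
  show "\<chi> x ^ n * cnj (\<chi> x ^ n) = 1" if "x \<noteq> 0" for x
  proof -
    obtain k where k: "\<chi> x = \<i> ^ k"
      using \<open>x \<noteq> 0\<close> by (metis \<chi>_cases)
    have "\<chi> x ^ n * cnj (\<chi> x ^ n) = ((\<i> * cnj \<i>) ^ k) ^ n"
      unfolding k by (simp only: power_mult_distrib complex_cnj_power)
    then show ?thesis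
      by simp
  qed
  obtain y :: 'a where "y \<noteq> 0" "y ^ (m * n) \<noteq> 1"
    using exists_power_neq_1[where 'a = 'a, of "m * n"] assms card m_pos by auto
  then show "\<exists>x. x \<noteq> 0 \<and> \<chi> x ^ n \<noteq> 1"
    using \<chi>_eq_1_iff by blast
qed (use assms in \<open>auto simp: \<chi>_mult power_mult_distrib\<close>)

sublocale \<chi>: multiplicative_character \<chi>
  using multiplicative_character_\<chi>_power[of 1] by simp

lemma \<chi>_minus_1: "\<chi> (-1) = 1"
  using m4 \<chi>_eqI[of "-1" 0] by auto

lemma \<chi>_square_cases:
  assumes "x \<noteq> 0"
  shows "\<chi> x ^ 2 = 1 \<or> \<chi> x ^ 2 = -1"
proof -
  obtain k where k: "\<chi> x = \<i> ^ k"
    using assms by (metis \<chi>_cases)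
  have "\<chi> x ^ 2 = (\<i>\<^sup>2) ^ k"
    unfolding k by (simp only: mult.commute flip: power_mult)
  then show ?thesis
    by (cases "even k") auto
qed

text \<open>Up to the fourth power \<open>\<iota>\<close>, the element \<open>2\<close> is the square of \<open>1 + \<iota>\<close>.\<close>
lemma \<chi>_two: "\<chi> 2 = 1 \<or> \<chi> 2 = -1"
proof -
  have "\<iota> \<noteq> 0"
    using \<iota> by auto
  obtain n where "m = 4 * n"
    using m4 by blast
  then have "\<iota> ^ m = \<iota> ^ 0"
    unfolding \<iota>_power_eq_iff by (simp add: cong_def)
  then have "\<chi> \<iota> = 1"
    using \<chi>_eqI[of \<iota> 0] \<open>\<iota> \<noteq> 0\<close> by simp
  have "(1 + \<iota>) * (1 + \<iota>) = 2 * \<iota>"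
    using \<iota> by (simp add: algebra_simps power2_eq_square)
  then have "\<chi> (1 + \<iota>) ^ 2 = \<chi> 2"
    using \<chi>_mult[of "1 + \<iota>" "1 + \<iota>"] \<chi>_mult[of 2 \<iota>] \<open>\<chi> \<iota> = 1\<close> by (simp add: power2_eq_square)
  moreover have "1 + \<iota> \<noteq> 0"
    using \<open>(1 + \<iota>) * (1 + \<iota>) = 2 * \<iota>\<close> two_neq_0 \<open>\<iota> \<noteq> 0\<close> by auto
  ultimately show ?thesis
    using \<chi>_square_cases by metis
qed

lemma gauss_int_\<chi>: "gauss_int (\<chi> x)"
proof (cases "x = 0")
  case False
  then obtain k where k: "\<chi> x = \<i> ^ k"
    by (metis \<chi>_cases)
  show ?thesis
    unfolding k by (intro gauss_red_power gauss_red_imaginary_unit) simp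
qed (simp add: gauss_red_0)

abbreviation J :: complex where "J \<equiv> jacobi_sum \<chi>"

text \<open>Every power of \<open>\<i>\<close> is 1 modulo the prime \<open>1 + \<i>\<close> above
  2; the four quotients are listed case by case.\<close>

lemma gauss_int_\<chi>_minus_1_div:
  assumes "x \<noteq> 0"
  shows "gauss_int ((\<chi> x - 1) / (1 + \<i>))"
proof -
  obtain k where k: "\<chi> x = \<i> ^ k" "k < 4"
    using assms by (metis \<chi>_cases)
  have int: "gauss_int (-1)" "gauss_int 0" "gauss_int \<i>"
    using gauss_red_of_int[of \<i> "-1"] gauss_red_0 gauss_red_imaginary_unit by simp_all
  have "\<exists>w. gauss_int w \<and> \<chi> x - 1 = w * (1 + \<i>)"
  proof -
    have "k = 0 \<or> k = 1 \<or> k = 2 \<or> k = 3"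
      using k(2) by auto
    then show ?thesis
    proof (elim disjE)
      assume "k = 0"
      then show ?thesis
        using int by (intro exI[of _ 0]) (simp add: k)
    next
      assume "k = 1"
      then show ?thesis
        using int by (intro exI[of _ \<i>]) (simp add: k algebra_simps)
    next
      assume "k = 2"
      then show ?thesis
        using gauss_red_add[OF int(1,3)] by (intro exI[of _ "-1 + \<i>"]) (simp add: k algebra_simps)
    next
      assume "k = 3"
      then show ?thesis
        using int by (intro exI[of _ "-1"]) (simp add: k eval_nat_numeral)
    qed
  qed
  then obtain w where "gauss_int w" "\<chi> x - 1 = w * (1 + \<i>)"
    by blast
  moreover have "1 + \<i> \<noteq> 0"
    by (simp add: complex_eq_iff)
  ultimately show ?thesis
    by simp
qed

text \<open>
  Expand \<open>\<Sum>(\<chi> x - 1) * (\<chi> (1 - x) - 1)\<close> over \<open>x \<noteq> 0, 1\<close>. Every summand is divisible by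
  \<open>(1 + \<i>)\<^sup>2 = 2 * \<i>\<close>, and the summands for \<open>x\<close> and \<open>1 - x\<close> agree.
\<close>
lemma jacobi_sum_mod_4: "gauss_int ((J + of_nat CARD('a)) / 4)"
proof -
  define f where "f x = (\<chi> x - 1) * (\<chi> (1 - x) - 1)" for x
  \<comment> \<open>\<open>h\<close> is the only fixed point of \<open>x \<mapsto> 1 - x\<close> and
    has to be split off before pairing.\<close>
  define h :: 'a where "h = 1 / 2"
  have "(1 :: 'a) \<noteq> 2"
    by (metis add_cancel_right_right one_add_one zero_neq_one)
  then have h: "1 - h = h" "h \<noteq> 0" "h \<noteq> 1" "2 * h = 1"
    using two_neq_0 by (auto simp: h_def field_simps)
  have A: "sum g UNIV = g 0 + (g 1 + sum g (UNIV - {0, 1}))" for g :: "'a \<Rightarrow> complex"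
    by (simp add: sum.remove[of UNIV 0] sum.remove[of "UNIV - {0}" 1] flip: Diff_insert2)
  have "(\<Sum>x\<in>UNIV. \<chi> (1 - x)) = (\<Sum>x\<in>UNIV. \<chi> x)"
    by (rule sum.reindex_bij_witness[of _ "\<lambda>x. 1 - x" "\<lambda>x. 1 - x"]) auto
  then have S2: "(\<Sum>x\<in>UNIV - {0, 1}. \<chi> (1 - x)) = -1"
    using A[of "\<lambda>x. \<chi> (1 - x)"] \<chi>.sum_eq_0 by (simp add: add_eq_0_iff)
  have S1: "(\<Sum>x\<in>UNIV - {0, 1}. \<chi> x) = -1"
    using A[of \<chi>] \<chi>.sum_eq_0 by (simp add: add_eq_0_iff)
  have S3: "(\<Sum>x\<in>UNIV - {0, 1}. \<chi> x * \<chi> (1 - x)) = J"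
    using A[of "\<lambda>x. \<chi> x * \<chi> (1 - x)"] by (simp add: jacobi_sum_def)
  have S4: "(\<Sum>x\<in>UNIV - {0, 1 :: 'a}. 1 :: complex) = of_nat CARD('a) - 2"
    using A[of "\<lambda>_. 1"] by simp
  have "(\<Sum>x\<in>UNIV - {0, 1}. f x)
      = (\<Sum>x\<in>UNIV - {0, 1}. \<chi> x * \<chi> (1 - x) - \<chi> x - \<chi> (1 - x) + 1)"
    by (simp add: f_def algebra_simps)
  also have "\<dots> = J + of_nat CARD('a)"
    unfolding sum.distrib sum_subtractf S1 S2 S3 S4 by simp
  finally have "J + of_nat CARD('a) = (\<Sum>x\<in>UNIV - {0, 1}. f x)" ..
  also have "\<dots> = f h + (\<Sum>x\<in>UNIV - {0, 1, h}. f x)"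
    using h by (subst sum.remove[of _ h]) (auto intro!: arg_cong2[where f = sum])
  finally have J: "J + of_nat CARD('a) = f h + (\<Sum>x\<in>UNIV - {0, 1, h}. f x)" .
  have "1 - x \<in> UNIV - {0, 1, h} \<and> 1 - (1 - x) = x \<and> 1 - x \<noteq> x \<and> f (1 - x) = f x"
    if "x \<in> UNIV - {0, 1, h}" for x
  proof -
    have "1 - x \<noteq> x"
    proof
      assume "1 - x = x"
      then have "1 = x + x"
        by (simp only: diff_eq_eq)
      then have "2 * x = 2 * h"
        by (simp only: mult_2[of x] h(4))
      then show False
        using two_neq_0 that by simp
    qed
    moreover have "1 - x \<noteq> h"
    proof
      assume *: "1 - x = h"
      have "x = 1 - (1 - x)"
        by simp
      also have "\<dots> = h"
        unfolding * by (rule h)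
      finally show False
        using that by simp
    qed
    ultimately show ?thesis
      using that by (auto simp: f_def mult.commute)
  qed
  then obtain B where B: "B \<subseteq> UNIV - {0, 1, h}" "(\<Sum>x\<in>UNIV - {0, 1, h}. f x) = 2 * sum f B"
    using sum_involution[of "UNIV - {0, 1, h}" "\<lambda>x. 1 - x" f] by auto
  have "gauss_int (f x / 2)" if "x \<in> B" for x
  proof -
    have "x \<noteq> 0" "1 - x \<noteq> 0"
      using that B by auto
    then have "gauss_int (\<i> * (((\<chi> x - 1) / (1 + \<i>)) * ((\<chi> (1 - x) - 1) / (1 + \<i>))))"
      by (intro gauss_red_mult gauss_red_imaginary_unit gauss_int_\<chi>_minus_1_div) auto
    moreover have "(1 + \<i>) * (1 + \<i>) = 2 * \<i>"
      by (simp add: algebra_simps)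
    ultimately show ?thesis
      by (simp add: f_def)
  qed
  then have "gauss_int (\<Sum>x\<in>B. f x / 2)"
    by (rule gauss_red_sum)
  then have "gauss_int (2 * sum f B / 4)"
    by (simp add: sum_divide_distrib)
  \<comment> \<open>As \<open>\<chi> h\<close> is 1 or -1, the unpaired term
    \<open>(\<chi> h - 1)\<^sup>2\<close> is 0 or 4.\<close>
  moreover have "gauss_int (f h / 4)"
  proof -
    have "\<chi> 2 * \<chi> h = 1"
      using \<chi>_mult[of 2 h] h by simp
    then have "\<chi> h = 1 \<or> \<chi> h = -1"
      using \<chi>_two by (auto simp: minus_equation_iff)
    then show ?thesis
      using gauss_red_0[of \<i>] gauss_red_1[of \<i>] by (auto simp: f_def h)
  qed
  ultimately have "gauss_int (f h / 4 + 2 * sum f B / 4)"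
    by (intro gauss_red_add)
  then show ?thesis
    by (simp only: J B(2) add_divide_distrib)
qed

text \<open>
  Reducing \<open>\<i>\<close> to \<open>- \<iota>\<close> turns \<open>\<chi> x\<close> into \<open>x ^ (3 * m)\<close>; the power sums then kill every term of
  the binomial expansion but one.
\<close>
lemma gauss_red_jacobi_sum:
  "gauss_red (- \<iota>) J (- ((-1) ^ m * of_nat (3 * m choose m)))"
proof -
  have \<iota>': "(- \<iota>)\<^sup>2 = -1"
    using \<iota> by simp
  have \<iota>3: "\<iota> ^ 3 = - \<iota>"
    using \<iota> by (simp add: eval_nat_numeral)
  have red: "gauss_red (- \<iota>) (\<chi> x) (x ^ (3 * m))" for x
  proof (cases "x = 0")
    case False
    then obtain k where k: "x ^ m = \<iota> ^ k" "\<chi> x = \<i> ^ k"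
      by (metis \<chi>_cases)
    have "x ^ (3 * m) = (x ^ m) ^ 3"
      by (simp only: mult.commute flip: power_mult)
    also have "\<dots> = (\<iota> ^ 3) ^ k"
      unfolding k by (simp only: mult.commute flip: power_mult)
    finally have eq: "x ^ (3 * m) = (- \<iota>) ^ k"
      unfolding \<iota>3 .
    show ?thesis
      unfolding eq k(2) by (intro gauss_red_power gauss_red_imaginary_unit \<iota>')
  qed (use m_pos gauss_red_0 in \<open>simp add: power_0_left\<close>)
  have "gauss_red (- \<iota>) J (\<Sum>x\<in>UNIV. x ^ (3 * m) * (1 - x) ^ (3 * m))"
    unfolding jacobi_sum_def by (intro gauss_red_sum gauss_red_mult red \<iota>')
  also have "(\<Sum>x\<in>UNIV. (x :: 'a) ^ (3 * m) * (1 - x) ^ (3 * m))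
      = (\<Sum>x\<in>UNIV. \<Sum>k\<le>3 * m. of_nat (3 * m choose k) * (-1) ^ k * x ^ (3 * m + k))"
  proof (rule sum.cong[OF refl])
    fix x :: 'a
    have "(1 - x) ^ (3 * m) = (- x + 1) ^ (3 * m)"
      by simp
    also have "\<dots> = (\<Sum>k\<le>3 * m. of_nat (3 * m choose k) * (- x) ^ k * 1 ^ (3 * m - k))"
      by (rule binomial_ring)
    finally show "x ^ (3 * m) * (1 - x) ^ (3 * m)
        = (\<Sum>k\<le>3 * m. of_nat (3 * m choose k) * (-1) ^ k * x ^ (3 * m + k))"
      by (simp add: sum_distrib_left power_add power_minus[of x] mult_ac)
  qed
  also have "\<dots> = (\<Sum>k\<le>3 * m. of_nat (3 * m choose k) * (-1) ^ k * (\<Sum>x\<in>UNIV. x ^ (3 * m + k)))"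
    by (subst sum.swap) (simp add: sum_distrib_left)
  also have "\<dots> = (\<Sum>k\<le>3 * m. if k = m then - (of_nat (3 * m choose m) * (-1) ^ m) else 0)"
  proof (rule sum.cong[OF refl])
    fix k assume "k \<in> {..3 * m}"
    then have k: "k \<le> 3 * m"
      by simp
    show "of_nat (3 * m choose k) * (-1) ^ k * (\<Sum>x\<in>UNIV. x ^ (3 * m + k))
        = (if k = m then - (of_nat (3 * m choose m) * (-1) ^ m) else (0 :: 'a))"
    proof (cases "k = m")
      case True
      then have "3 * m + k = CARD('a) - 1"
        using card by simp
      then have "(\<Sum>x\<in>UNIV. (x :: 'a) ^ (3 * m + k)) = -1"
        using sum_powers_card_minus_1[where 'a = 'a] by (simp only:)
      with True show ?thesis
        by simp
    next
      case False
      \<comment> \<open>The exponent lies between \<open>3 * m\<close> and \<open>6 * m\<close>, so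
        \<open>4 * m\<close> is the only multiple available, and it occurs for
        \<open>k = m\<close>.\<close>
      have "\<not> 4 * m dvd 3 * m + k"
      proof
        assume "4 * m dvd 3 * m + k"
        then obtain c where c: "3 * m + k = 4 * m * c" ..
        have "c \<noteq> 0"
          using c m_pos by (cases c) auto
        moreover have "c \<noteq> 1"
          using c False by auto
        ultimately have "4 * m * 2 \<le> 3 * m + k"
          unfolding c by (intro mult_left_mono) auto
        then show False
          using k m_pos by simp
      qed
      then show ?thesis
        using False sum_powers_eq_0[where 'a = 'a, of "3 * m + k"] card by simp
    qed
  qed
  also have "\<dots> = - ((-1) ^ m * of_nat (3 * m choose m))"
    by simp
  finally show ?thesis .
qed

end

section \<open>The spectrum in terms of the quartic Gauss sum\<close>

text \<open>For the target \<open>\<gamma> = p ^ l * (c1 + 2 * d1 * \<i>) ^ l\<close>, the real part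
  is \<open>p ^ l\<close> times \<open>c_seq\<close> and the imaginary part is
  \<open>2 * p ^ l\<close> times \<open>d_seq\<close>.\<close>

definition quartic_spectrum :: "nat \<Rightarrow> complex \<Rightarrow> complex \<Rightarrow> complex multiset" where
  "quartic_spectrum n P \<gamma> = {# of_nat n #}
     + replicate_mset n ((P + 2 * of_real (Im \<gamma>) - 1) / 4)
     + replicate_mset n ((P - 2 * of_real (Im \<gamma>) - 1) / 4)
     + replicate_mset n ((- P + 2 * of_real (Re \<gamma>) - 1) / 4)
     + replicate_mset n ((- P - 2 * of_real (Re \<gamma>) - 1) / 4)"

text \<open>Equality of squares up to conjugation fixes \<open>\<gamma>\<close> up to sign and
  conjugation. Both operations only permute the four values.\<close>

lemma quartic_spectrum_cong:
  assumes "\<gamma>\<^sup>2 = \<delta>\<^sup>2 \<or> \<gamma>\<^sup>2 = cnj (\<delta>\<^sup>2)"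
  shows "quartic_spectrum n P \<gamma> = quartic_spectrum n P \<delta>"
proof -
  have "\<gamma>\<^sup>2 = \<delta>\<^sup>2 \<or> \<gamma>\<^sup>2 = (cnj \<delta>)\<^sup>2"
    using assms by simp
  then have "\<gamma> = \<delta> \<or> \<gamma> = - \<delta> \<or> \<gamma> = cnj \<delta> \<or> \<gamma> = - cnj \<delta>"
    by (auto simp: power2_eq_iff)
  moreover have eq: "- (2 * r) - P - 1 = - P - 2 * r - 1" for r :: complex
    by simp
  ultimately show ?thesis
    by (auto simp: quartic_spectrum_def union_ac eq)
qed

section \<open>Classes of nonzero elements modulo fourth powers\<close>

context quartic_field
begin

text \<open>Each fourth power has at most 4 fourth roots, so there are at least \<open>m\<close>
  fourth powers, while \<open>x ^ m = 1\<close> has at most \<open>m\<close> solutions.\<close>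

lemma nonzero_powers_4_eq: "nonzero_powers 4 = {x :: 'a. x ^ m = 1}"
proof (rule card_seteq)
  show "nonzero_powers 4 \<subseteq> {x :: 'a. x ^ m = 1}"
    using power_4m by (auto simp: nonzero_powers_def mult.commute simp flip: power_mult)
  let ?S = "nonzero_powers 4 :: 'a set"
  have "4 * m = card (UNIV - {0 :: 'a})"
    using card by simp
  also have "\<dots> \<le> card (\<Union>s\<in>?S. {x. x ^ 4 = s})"
    by (rule card_mono) (auto simp: nonzero_powers_def)
  also have "\<dots> \<le> (\<Sum>s\<in>?S. card {x. x ^ 4 = s})"
    by (rule card_UN_le) simp
  also have "\<dots> \<le> of_nat (card ?S) * 4"
    by (rule sum_bounded_above) (simp add: card_roots_of_power_eq)
  finally have "m \<le> card ?S"
    by simp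
  then show "card {x :: 'a. x ^ m = 1} \<le> card ?S"
    using card_roots_of_power_eq[OF m_pos, of "1 :: 'a"] by simp
qed simp

text \<open>A coset of the fourth powers, given as a level set of \<open>x ^ m\<close> so that no
  generator has to be chosen.\<close>

definition coset :: "nat \<Rightarrow> 'a set" where
  "coset k = {x. x ^ m = \<iota> ^ k}"

lemma zero_notin_coset: "0 \<notin> coset k"
  using m_pos \<iota> by (auto simp: coset_def power_0_left)

lemma \<chi>_coset: "x \<in> coset k \<Longrightarrow> \<chi> x = \<i> ^ k"
  using \<chi>_eqI[of x k] zero_notin_coset[of k] by (auto simp: coset_def)

lemma coset_disjoint: "j < 4 \<Longrightarrow> k < 4 \<Longrightarrow> j \<noteq> k \<Longrightarrow> coset j \<inter> coset k = {}"
  using \<iota>_power_eq_iff[of j k] by (auto simp: coset_def cong_def)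

lemma UNIV_eq_cosets: "UNIV - {0} = (\<Union>k<4. coset k)"
proof -
  have "x \<in> (\<Union>k<4. coset k)" if "x \<noteq> 0" for x
  proof (rule \<chi>_cases[OF that])
    fix k
    assume "k < 4" "x ^ m = \<iota> ^ k"
    then have "k \<in> {..<4}" "x \<in> coset k"
      by (simp_all add: coset_def)
    then show ?thesis
      by (rule UN_I)
  qed
  then show ?thesis
    using zero_notin_coset by auto
qed

text \<open>Four sets of at most \<open>m\<close> elements cover all \<open>4 * m\<close> nonzero
  elements, so none can be smaller.\<close>

lemma card_coset:
  assumes "k < 4"
  shows "card (coset k) = m"
proof (rule ccontr)
  have le: "card (coset j) \<le> m" for j
    unfolding coset_def by (rule card_roots_of_power_eq) (rule m_pos)
  assume "card (coset k) \<noteq> m"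
  then have "card (coset k) < m"
    using le[of k] by simp
  then have "(\<Sum>j<4. card (coset j)) < (\<Sum>j<4::nat. m)"
    using assms le by (intro sum_strict_mono_ex1) auto
  also have "\<dots> = card (UNIV - {0 :: 'a})"
    using card by simp
  also have "\<dots> = card (\<Union>j<4. coset j)"
    by (simp only: UNIV_eq_cosets)
  also have "\<dots> \<le> (\<Sum>j<4. card (coset j))"
    by (rule card_UN_le) simp
  finally show False
    by simp
qed

lemma image_mset_cosets:
  fixes f :: "'a \<Rightarrow> complex"
  assumes "f 0 = c" and "\<And>k x. k < 4 \<Longrightarrow> x \<in> coset k \<Longrightarrow> f x = g k"
  shows "image_mset f (mset_set UNIV) = {#c#} + replicate_mset m (g 0)
    + replicate_mset m (g 1) + replicate_mset m (g 2) + replicate_mset m (g 3)"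
proof -
  have const: "image_mset f (mset_set (coset k)) = replicate_mset m (g k)" if "k < 4" for k
  proof -
    have "image_mset f (mset_set (coset k)) = image_mset (\<lambda>_. g k) (mset_set (coset k))"
      by (rule image_mset_cong) (use assms(2)[OF that] in auto)
    then show ?thesis
      by (simp add: image_mset_const_eq card_coset[OF that])
  qed
  have "UNIV = insert 0 (UNIV - {0 :: 'a})"
    by auto
  also have "UNIV - {0} = coset 0 \<union> coset 1 \<union> coset 2 \<union> coset 3"
    unfolding UNIV_eq_cosets by (auto simp: numeral_eq_Suc less_Suc_eq)
  finally have U: "UNIV = insert 0 (coset 0 \<union> coset 1 \<union> coset 2 \<union> coset 3)" .
  have "mset_set (UNIV :: 'a set) = {#0#} + mset_set (coset 0)
      + mset_set (coset 1) + mset_set (coset 2) + mset_set (coset 3)"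
    unfolding U
    by (subst mset_set.insert, simp, use zero_notin_coset in simp)
      (simp add: mset_set_Union Int_Un_distrib2 coset_disjoint)
  then show ?thesis
    by (simp add: const assms(1))
qed

lemma \<chi>_power_4: "x \<noteq> 0 \<Longrightarrow> \<chi> x ^ 4 = 1"
  using \<chi>_eq_1_iff power_4m by (simp add: power_mult)

lemma cnj_\<chi>: "cnj (\<chi> x) = \<chi> x ^ 3"
proof (cases "x = 0")
  case False
  have "\<chi> x * cnj (\<chi> x) = \<chi> x * \<chi> x ^ 3"
    using \<chi>.cnj_mult[OF False] \<chi>_power_4[OF False] by (simp flip: power_Suc)
  moreover have "\<chi> x \<noteq> 0"
    using \<chi>.cnj_mult[OF False] by auto
  ultimately show ?thesis
    by (simp only: mult_cancel_left simp_thms)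
qed simp

lemma cnj_\<chi>_square: "cnj (\<chi> x ^ 2) = \<chi> x ^ 2"
proof (cases "x = 0")
  case False
  then show ?thesis
    using \<chi>_square_cases by (metis complex_cnj_minus complex_cnj_one)
qed simp

text \<open>Orthogonality: the powers of \<open>\<chi>\<close> expand 4 times the indicator of the
  fourth powers.\<close>

lemma sum_\<chi>_powers:
  assumes "x \<noteq> 0"
  shows "1 + \<chi> x + \<chi> x ^ 2 + \<chi> x ^ 3 = (if x ^ m = 1 then 4 else 0)"
proof (cases "x ^ m = 1")
  case True
  then have "\<chi> x = 1"
    using \<chi>_eq_1_iff[OF assms, of 1] by simp
  then show ?thesis
    using True by simp
next
  case False
  then have "\<chi> x \<noteq> 1"
    using \<chi>_eq_1_iff[OF assms, of 1] by simp
  moreover have "(\<chi> x - 1) * (1 + \<chi> x + \<chi> x ^ 2 + \<chi> x ^ 3) = \<chi> x ^ 4 - 1"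
    by (simp add: algebra_simps eval_nat_numeral)
  ultimately show ?thesis
    using False \<chi>_power_4[OF assms] by simp
qed

end

section \<open>Quartic Gauss sums and the eigenvalues\<close>

locale quartic_gauss = quartic_field \<iota> m + \<psi>: additive_character \<psi>
  for \<iota> :: "'a::{field,finite}" and m and \<psi> :: "'a \<Rightarrow> complex"
begin

abbreviation "G \<equiv> gauss_sum \<chi> \<psi>"
abbreviation "D \<equiv> gauss_sum (\<lambda>x. \<chi> x ^ 2) \<psi>"

sublocale \<chi>1: gauss_sum_characters \<psi> \<chi> ..

sublocale \<chi>2: gauss_sum_characters \<psi> "\<lambda>x. \<chi> x ^ 2"
  using multiplicative_character_\<chi>_power[of 2]
  by (intro gauss_sum_characters.intro \<psi>.additive_character_axioms) simp

sublocale \<chi>3: gauss_sum_characters \<psi> "\<lambda>x. \<chi> x ^ 3"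
  using multiplicative_character_\<chi>_power[of 3]
  by (intro gauss_sum_characters.intro \<psi>.additive_character_axioms) simp

lemma gauss_sum_cube: "gauss_sum (\<lambda>x. \<chi> x ^ 3) \<psi> = cnj G"
proof -
  have "gauss_sum (\<lambda>x. \<chi> x ^ 3) \<psi> = cnj (\<Sum>x\<in>UNIV. \<chi> x * \<psi> (-1 * x))"
    by (simp add: gauss_sum_def \<psi>.cnj flip: cnj_\<chi>)
  also have "\<dots> = cnj G"
    by (subst \<chi>1.gauss_sum_twist) (simp_all add: \<chi>_minus_1)
  finally show ?thesis .
qed

lemma cnj_D: "cnj D = D"
proof -
  have "cnj D = (\<Sum>x\<in>UNIV. cnj (\<chi> x ^ 2) * cnj (\<psi> x))"
    by (simp add: gauss_sum_def)
  also have "\<dots> = (\<Sum>x\<in>UNIV. \<chi> x ^ 2 * \<psi> (-1 * x))"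
    unfolding cnj_\<chi>_square \<psi>.cnj by simp
  also have "\<dots> = D"
    by (subst \<chi>2.gauss_sum_twist) (simp_all add: \<chi>_minus_1)
  finally show ?thesis .
qed

lemma G_square: "G ^ 2 = J * D"
  by (rule \<chi>1.gauss_sum_square) (use multiplicative_character_\<chi>_power[of 2] in \<open>simp_all add: \<chi>_minus_1\<close>)

text \<open>Compare squared absolute values in \<open>G_square\<close>: both Gauss sums contribute
  \<open>q\<close>, which leaves \<open>q\<close> for \<open>J\<close>.\<close>

lemma J_mult_cnj: "J * cnj J = of_nat CARD('a)"
proof -
  define q :: complex where "q = of_nat CARD('a)"
  have "q \<noteq> 0"
    by (simp add: q_def)
  have GG: "G * cnj G = q" and DD: "D * cnj D = q"
    unfolding q_def by (rule \<chi>1.gauss_sum_mult_cnj \<chi>2.gauss_sum_mult_cnj)+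
  have "J * cnj J * q = (J * D) * cnj (J * D)"
    unfolding DD[symmetric] by simp
  also have "\<dots> = (G * cnj G) * (G * cnj G)"
    unfolding G_square[symmetric] by (simp add: power2_eq_square)
  finally show ?thesis
    using \<open>q \<noteq> 0\<close> unfolding GG by (simp add: q_def)
qed

text \<open>Expanding the indicator of the fourth powers in characters turns the Gauss period into
  twisted Gauss sums. The trivial character contributes nothing for nonzero
  \<open>a\<close>.\<close>

lemma eigenvalue:
  assumes "a \<noteq> 0"
  shows "(\<Sum>s\<in>nonzero_powers 4. \<psi> (a * s))
    = (cnj (\<chi> a) * G + \<chi> a ^ 2 * D + \<chi> a * cnj G - 1) / 4"
proof -
  have ne: "x \<noteq> 0" if "x ^ m = 1" for x :: 'a
    using that m_pos by (auto simp: power_0_left)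
  have "4 * (\<Sum>s\<in>nonzero_powers 4. \<psi> (a * s))
      = (\<Sum>x\<in>UNIV - {0}. (if x ^ m = 1 then 4 else 0) * \<psi> (a * x))"
    unfolding nonzero_powers_4_eq sum_distrib_left
    by (rule sum.mono_neutral_cong_left) (use ne in auto)
  also have "\<dots> = (\<Sum>x\<in>UNIV - {0}. (1 + \<chi> x + \<chi> x ^ 2 + \<chi> x ^ 3) * \<psi> (a * x))"
    by (rule sum.cong) (simp_all add: sum_\<chi>_powers)
  \<comment> \<open>The \<open>- 1\<close> removes the added term at \<open>x = 0\<close>, where
    only the constant 1 survives.\<close>
  also have "\<dots> = (\<Sum>x\<in>UNIV. (1 + \<chi> x + \<chi> x ^ 2 + \<chi> x ^ 3) * \<psi> (a * x)) - 1"
    by (simp add: sum.remove[of UNIV 0])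
  also have "(\<Sum>x\<in>UNIV. (1 + \<chi> x + \<chi> x ^ 2 + \<chi> x ^ 3) * \<psi> (a * x))
      = (\<Sum>x\<in>UNIV. \<psi> (a * x)) + (\<Sum>x\<in>UNIV. \<chi> x * \<psi> (a * x))
        + (\<Sum>x\<in>UNIV. \<chi> x ^ 2 * \<psi> (a * x)) + (\<Sum>x\<in>UNIV. \<chi> x ^ 3 * \<psi> (a * x))"
    by (simp add: distrib_right sum.distrib)
  also have "\<dots> = cnj (\<chi> a) * G + cnj (\<chi> a ^ 2) * D + cnj (\<chi> a ^ 3) * cnj G"
    unfolding \<psi>.sum_mult \<chi>1.gauss_sum_twist[OF assms] \<chi>2.gauss_sum_twist[OF assms]
      \<chi>3.gauss_sum_twist[OF assms] gauss_sum_cube using assms by simp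
  also have "cnj (\<chi> a ^ 3) = \<chi> a"
    by (simp flip: cnj_\<chi>)
  finally show ?thesis
    unfolding cnj_\<chi>_square by (simp add: mult.commute)
qed

lemma spectrum:
  assumes "CARD('a) = P\<^sup>2"
  shows "\<exists>\<gamma>. \<gamma>\<^sup>2 = - of_nat P * J
    \<and> graph_spectrum (generalized_paley 4 :: 'a pair_pre_digraph) = quartic_spectrum m (of_nat P) \<gamma>"
proof -
  define ev where "ev a = (\<Sum>s\<in>nonzero_powers 4. \<psi> (a * s))" for a
  define g where "g k = (cnj (\<i> ^ k) * G + (\<i> ^ k) ^ 2 * D + \<i> ^ k * cnj G - 1) / 4" for k
  have "ev 0 = of_nat m"
    using card_coset[of 0] unfolding ev_def nonzero_powers_4_eq coset_def by simp
  moreover have "ev x = g k" if "x \<in> coset k" for x k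
  proof -
    have "x \<noteq> 0"
      using that zero_notin_coset by metis
    then show ?thesis
      unfolding ev_def g_def \<chi>_coset[OF that, symmetric] by (rule eigenvalue)
  qed
  ultimately have "image_mset ev (mset_set UNIV) = {#of_nat m#} + replicate_mset m (g 0)
      + replicate_mset m (g 1) + replicate_mset m (g 2) + replicate_mset m (g 3)"
    by (intro image_mset_cosets) auto
  then have spec: "graph_spectrum (generalized_paley 4 :: 'a pair_pre_digraph)
      = {#of_nat m#} + replicate_mset m (g 0)
        + replicate_mset m (g 1) + replicate_mset m (g 2) + replicate_mset m (g 3)"
    unfolding generalized_paley_def \<psi>.graph_spectrum_cayley_digraph ev_def[abs_def] .
  have g: "g 0 = (D + 2 * of_real (Re G) - 1) / 4" "g 1 = (- D + 2 * of_real (Im G) - 1) / 4"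
    "g 2 = (D - 2 * of_real (Re G) - 1) / 4" "g 3 = (- D - 2 * of_real (Im G) - 1) / 4"
    by (simp_all add: g_def complex_eq_iff eval_nat_numeral)
  have "D * D = of_nat P * of_nat P"
    using \<chi>2.gauss_sum_mult_cnj unfolding cnj_D assms by (simp add: power2_eq_square)
  then have "D = of_nat P \<or> D = - of_nat P"
    by (simp add: square_eq_iff)
  then show ?thesis
  proof
    assume D: "D = of_nat P"
    \<comment> \<open>The factor \<open>\<i>\<close> interchanges real and imaginary parts up to
      sign, so that the pair containing \<open>P\<close> uses the imaginary part for either sign of
      \<open>D\<close>.\<close>
    have "(\<i> * G)\<^sup>2 = - of_nat P * J"
      using G_square by (simp add: power_mult_distrib D)
    moreover have "graph_spectrum (generalized_paley 4 :: 'a pair_pre_digraph)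
        = quartic_spectrum m (of_nat P) (\<i> * G)"
      unfolding spec g D by (simp add: quartic_spectrum_def union_ac)
    ultimately show ?thesis
      by blast
  next
    assume D: "D = - of_nat P"
    have "G\<^sup>2 = - of_nat P * J"
      using G_square by (simp add: D)
    moreover have "graph_spectrum (generalized_paley 4 :: 'a pair_pre_digraph)
        = quartic_spectrum m (of_nat P) G"
      unfolding spec g D by (simp add: quartic_spectrum_def union_ac)
    ultimately show ?thesis
      by blast
  qed
qed

lemma jacobi_sum_decomposition:
  assumes "prime p" "[p = 1] (mod 4)" and q: "CARD('a) = p ^ k"
  obtains a b :: int where "J = of_int a + of_int b * \<i>" "a\<^sup>2 + b\<^sup>2 = int p ^ k"
    "\<not> int p dvd a" "4 dvd a + 1" "4 dvd b"
proof -
  have char: "CHAR('a) = p"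
    using assms(1) q by (rule CHAR_eq_prime)
  have "k > 0"
    using one_less_CARD[where 'a = 'a] q by (cases k) auto
  obtain u v where uv: "(J + of_nat CARD('a)) / 4 = of_int u + of_int v * \<i>"
    using jacobi_sum_mod_4 unfolding gauss_red_def by blast
  define a b where "a = 4 * u - int CARD('a)" and "b = 4 * v"
  have "J + of_nat CARD('a) = 4 * (of_int u + of_int v * \<i>)"
    unfolding uv[symmetric] by simp
  then have J: "J = of_int a + of_int b * \<i>"
    by (simp add: a_def b_def algebra_simps)
  \<comment> \<open>Since \<open>q = 4 * m + 1\<close>, the number \<open>a + 1\<close> is
    \<open>4 * (u - m)\<close>.\<close>
  have "4 dvd a + 1"
    by (simp add: a_def card)
  have "4 dvd b"
    by (simp add: b_def)
  have "complex_of_int (a\<^sup>2 + b\<^sup>2) = J * cnj J"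
    unfolding J by (simp add: complex_eq_iff power2_eq_square)
  also have "\<dots> = complex_of_int (int p ^ k)"
    unfolding J_mult_cnj q by simp
  finally have norm: "a\<^sup>2 + b\<^sup>2 = int p ^ k"
    by (simp only: of_int_eq_iff)
  have "\<not> int p dvd a"
  proof
    assume pa: "int p dvd a"
    have "int p dvd int p ^ k - a * a"
      using pa \<open>k > 0\<close> by (intro dvd_diff dvd_power dvd_mult) auto
    also have "int p ^ k - a * a = b * b"
      using norm by (simp add: power2_eq_square)
    finally have pb: "int p dvd b"
      using assms(1) by (simp add: prime_dvd_mult_iff)
    obtain a' b' where ab': "J = of_int a' + of_int b' * \<i>"
        "- ((-1) ^ m * of_nat (3 * m choose m)) = of_int a' + of_int b' * (- \<iota>)"
      using gauss_red_jacobi_sum unfolding gauss_red_def by blast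
    then have "a' = a" "b' = b"
      using J by (simp_all add: complex_eq_iff)
    moreover have "of_int a = (0 :: 'a)" "of_int b = (0 :: 'a)"
      using pa pb by (simp_all add: of_int_eq_0_iff_char_dvd char)
    ultimately have "of_nat (3 * m choose m) = (0 :: 'a)"
      using ab'(2) by simp
    then have "p dvd (3 * m choose m)"
      by (simp only: of_nat_eq_0_iff_char_dvd char)
    then show False
      using prime_not_dvd_choose[OF assms(1,2), of m k] card q by simp
  qed
  with J norm \<open>4 dvd a + 1\<close> \<open>4 dvd b\<close> show ?thesis
    by (intro that)
qed

end

section \<open>Uniqueness of the Jacobi sum and the final assembly\<close>

text \<open>The squares of both coordinates are determined, and the congruence modulo 4 fixes the
  sign of the real part; only conjugation remains.\<close>

lemma jacobi_sum_decomposition_unique: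
  fixes a b A B :: int
  assumes "prime p" "odd p" "k > 0"
    and "a\<^sup>2 + b\<^sup>2 = int p ^ k" "\<not> int p dvd a" "4 dvd a + 1" "4 dvd b"
    and "A\<^sup>2 + B\<^sup>2 = int p ^ k" "\<not> int p dvd A" "4 dvd A + 1" "4 dvd B"
  shows "A = a \<and> (B = b \<or> B = - b)"
proof -
  have "even b" "even B"
    using assms(7,11) by presburger+
  then have "a\<^sup>2 = A\<^sup>2 \<and> b\<^sup>2 = B\<^sup>2"
    using assms by (intro sum_of_two_squares_unique[of p _ _ k]) auto
  then have "(A = a \<or> A = - a) \<and> (B = b \<or> B = - b)"
    by (auto simp: power2_eq_iff)
  moreover have "A \<noteq> - a"
    using assms(6,10) by presburger
  ultimately show ?thesis
    by blast
qed

text \<open>The field enters only through integers \<open>a\<close>, \<open>b\<close> that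
  arithmetic determines up to the sign of \<open>b\<close>. Two field types of equal size can thus
  be compared without an isomorphism.\<close>

lemma spectrum_generalized_paley_4:
  assumes "prime p" "[p = 1] (mod 4)" "l \<ge> 1" and q: "CARD('a::{field,finite}) = p ^ (4 * l)"
  obtains a b :: int and \<gamma> :: complex where
    "a\<^sup>2 + b\<^sup>2 = int p ^ (4 * l)" "\<not> int p dvd a" "4 dvd a + 1" "4 dvd b"
    "\<gamma>\<^sup>2 = - of_nat (p ^ (2 * l)) * (of_int a + of_int b * \<i>)"
    "graph_spectrum (generalized_paley 4 :: 'a pair_pre_digraph)
       = quartic_spectrum ((p ^ (4 * l) - 1) div 4) (of_nat (p ^ (2 * l))) \<gamma>"
proof -
  define m where "m = (p ^ (4 * l) - 1) div 4"
  have "p mod 4 = 1"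
    using assms(2) by (simp add: cong_def)
  \<comment> \<open>The fourth powers of these residues are all 1 modulo 16, which gives
    \<open>4 dvd m\<close>.\<close>
  then have "p mod 16 \<in> {1, 5, 9, 13}"
    by simp presburger
  then have "(p mod 16) ^ 4 mod 16 = 1"
    by auto
  then have "[p ^ 4 = 1] (mod 16)"
    by (simp add: cong_def power_mod)
  then have "[(p ^ 4) ^ l = 1 ^ l] (mod 16)"
    by (rule cong_pow)
  then have "p ^ (4 * l) mod 16 = 1"
    by (simp add: cong_def power_mult)
  then have card: "CARD('a) = 4 * m + 1" and "4 dvd m"
    unfolding q m_def by presburger+
  obtain \<iota> :: 'a where "\<iota>\<^sup>2 = -1"
    using exists_sqrt_minus_1[OF card] by blast
  obtain \<psi> :: "'a \<Rightarrow> complex" where "additive_character \<psi>"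
    using exists_additive_character[OF assms(1) q] by blast
  interpret \<psi>: additive_character \<psi> by fact
  interpret quartic_gauss \<iota> m \<psi>
    by unfold_locales fact+
  obtain a b where ab: "J = of_int a + of_int b * \<i>" "a\<^sup>2 + b\<^sup>2 = int p ^ (4 * l)"
    "\<not> int p dvd a" "4 dvd a + 1" "4 dvd b"
    using jacobi_sum_decomposition[OF assms(1,2) q] by metis
  have "CARD('a) = (p ^ (2 * l))\<^sup>2"
    unfolding q by (simp add: mult.commute flip: power_mult)
  then obtain \<gamma> where "\<gamma>\<^sup>2 = - of_nat (p ^ (2 * l)) * J"
    "graph_spectrum (generalized_paley 4 :: 'a pair_pre_digraph)
      = quartic_spectrum m (of_nat (p ^ (2 * l))) \<gamma>"
    using spectrum by blast
  then show ?thesis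
    using that ab unfolding m_def by metis
qed

lemma size_graph_spectrum_cayley_digraph:
  assumes "prime p" "CARD('a::{field,finite}) = p ^ L"
  shows "size (graph_spectrum (cayley_digraph (S :: 'a set))) = CARD('a)"
proof -
  obtain \<psi> :: "'a \<Rightarrow> complex" where "additive_character \<psi>"
    using exists_additive_character[OF assms] by blast
  then interpret additive_character \<psi> .
  show ?thesis
    by (simp add: graph_spectrum_cayley_digraph)
qed

lemma quartic_spectrum_eqI:
  fixes a b a' b' :: int
  assumes "\<gamma>\<^sup>2 = c * (of_int a + of_int b * \<i>)" "\<delta>\<^sup>2 = c * (of_int a' + of_int b' * \<i>)"
    and "a' = a \<and> (b' = b \<or> b' = - b)" "cnj c = c"
  shows "quartic_spectrum n P \<gamma> = quartic_spectrum n P \<delta>"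
  using assms by (intro quartic_spectrum_cong) auto

text \<open>With \<open>z = c + 2 * d * \<i>\<close>, the trace recurrence makes the real part of
  each positive power a unit modulo \<open>p\<close>, and \<open>z\<^sup>2 \<equiv> 1\<close> modulo
  4 gives the congruences for even powers.\<close>

lemma gauss_int_powers:
  fixes c d :: int
  assumes "prime p" "odd p" and norm: "(int p)\<^sup>2 = c\<^sup>2 + 4 * d\<^sup>2"
    and c: "[c = 1] (mod 4)" "gcd c (int p) = 1" and "l \<ge> 1"
  obtains A B :: int where "(of_int c + 2 * of_int d * \<i>) ^ (2 * l) = of_int A + of_int B * \<i>"
    "A\<^sup>2 + B\<^sup>2 = int p ^ (4 * l)" "\<not> int p dvd A" "4 dvd A - 1" "4 dvd B"
proof -
  define z :: complex where "z = of_int c + 2 * of_int d * \<i>"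
  have "prime (int p)"
    using assms(1) by simp
  have pc: "\<not> int p dvd c"
  proof
    assume "int p dvd c"
    then have "int p dvd gcd c (int p)"
      by simp
    then show False
      using c(2) \<open>prime (int p)\<close> by (simp add: not_prime_unit)
  qed
  have p2: "\<not> int p dvd 2"
  proof
    assume "int p dvd 2"
    then have "p dvd 2"
      by presburger
    then show False
      using assms(1,2) by (metis primes_dvd_imp_eq two_is_prime_nat dvd_refl)
  qed
  have "complex_of_int ((int p)\<^sup>2) = of_int (c\<^sup>2 + 4 * d\<^sup>2)"
    unfolding norm ..
  then have norm': "z * cnj z = of_nat (p\<^sup>2)"
    by (simp add: z_def complex_eq_iff power2_eq_square)
  have "z\<^sup>2 = 2 * of_int c * z - z * cnj z"
    by (simp add: z_def complex_eq_iff power2_eq_square)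
  then have z2: "z\<^sup>2 = 2 * of_int c * z - of_nat (p\<^sup>2)"
    unfolding norm' .
  \<comment> \<open>Two consecutive powers are carried along because the recurrence has order 2.
    Modulo \<open>p\<close> it multiplies the real part by \<open>2 * c\<close>.\<close>
  have "\<exists>A B A' B' :: int. z ^ n = of_int A + of_int B * \<i> \<and> z ^ Suc n = of_int A' + of_int B' * \<i>
      \<and> \<not> int p dvd A'" for n
  proof (induction n)
    case 0
    show ?case
      using pc by (intro exI[of _ 1] exI[of _ 0] exI[of _ c] exI[of _ "2 * d"]) (simp add: z_def)
  next
    case (Suc n)
    then obtain A B A' B' :: int where IH: "z ^ n = of_int A + of_int B * \<i>"
      "z ^ Suc n = of_int A' + of_int B' * \<i>" "\<not> int p dvd A'"
      by blast
    have "z ^ Suc (Suc n) = z\<^sup>2 * z ^ n"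
      by (simp add: power2_eq_square)
    also have "\<dots> = 2 * of_int c * z ^ Suc n - of_nat (p\<^sup>2) * z ^ n"
      unfolding z2 by (simp add: algebra_simps)
    finally have "z ^ Suc (Suc n) = of_int (2 * c * A' - int p * (int p * A))
        + of_int (2 * c * B' - int p * (int p * B)) * \<i>"
      unfolding IH by (simp add: algebra_simps power2_eq_square)
    moreover have "\<not> int p dvd 2 * c * A' - int p * (int p * A)"
    proof
      assume "int p dvd 2 * c * A' - int p * (int p * A)"
      then have "int p dvd (2 * c * A' - int p * (int p * A)) + int p * (int p * A)"
        by (rule dvd_add) simp
      then show False
        using p2 pc IH(3) \<open>prime (int p)\<close> by (simp add: prime_dvd_mult_iff)
    qed
    ultimately show ?case
      using IH(2) by blast
  qed
  from this[of "2 * l - 1"] obtain A B :: int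
    where AB: "z ^ (2 * l) = of_int A + of_int B * \<i>" and "\<not> int p dvd A"
    using \<open>l \<ge> 1\<close> by auto
  have "complex_of_int (A\<^sup>2 + B\<^sup>2) = z ^ (2 * l) * cnj (z ^ (2 * l))"
    unfolding AB by (simp add: complex_eq_iff power2_eq_square)
  also have "\<dots> = (z * cnj z) ^ (2 * l)"
    by (simp add: power_mult_distrib)
  also have "\<dots> = complex_of_int (int p ^ (4 * l))"
    unfolding norm' by (simp flip: power_mult)
  finally have "A\<^sup>2 + B\<^sup>2 = int p ^ (4 * l)"
    by (simp only: of_int_eq_iff)
  have "4 dvd c - 1"
    using c(1) by (simp add: cong_iff_dvd_diff)
  then obtain e where "c - 1 = 4 * e" ..
  then have e: "c = 1 + 4 * e"
    by simp
  \<comment> \<open>This is \<open>(z\<^sup>2 - 1) / 4\<close>, written out with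
    \<open>c = 1 + 4 * e\<close> to show that it is a Gaussian integer.\<close>
  define w :: complex where "w = of_int (2 * e + 4 * e * e - d * d) + of_int (c * d) * \<i>"
  have "gauss_int w"
    unfolding w_def gauss_red_def by blast
  have "z\<^sup>2 = 1 + 4 * w"
    by (simp add: z_def w_def e complex_eq_iff power2_eq_square algebra_simps)
  have "\<exists>v. gauss_int v \<and> z ^ (2 * n) = 1 + 4 * v" for n
  proof (induction n)
    case 0
    show ?case
      using gauss_red_0 by (intro exI[of _ 0]) simp
  next
    case (Suc n)
    then obtain v where v: "gauss_int v" "z ^ (2 * n) = 1 + 4 * v"
      by blast
    have "z ^ (2 * Suc n) = z\<^sup>2 * z ^ (2 * n)"
      by (simp add: power2_eq_square)
    also have "\<dots> = 1 + 4 * (w + v + of_int 4 * (w * v))"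
      unfolding v \<open>z\<^sup>2 = 1 + 4 * w\<close> by (simp add: algebra_simps)
    finally have "z ^ (2 * Suc n) = 1 + 4 * (w + v + of_int 4 * (w * v))" .
    moreover have "gauss_int (w + v + of_int 4 * (w * v))"
      using v(1) \<open>gauss_int w\<close> by (intro gauss_red_add gauss_red_mult gauss_red_of_int) auto
    ultimately show ?case
      by blast
  qed
  then obtain v where "gauss_int v" "z ^ (2 * l) = 1 + 4 * v"
    by blast
  then obtain s t :: int where "z ^ (2 * l) = 1 + 4 * (of_int s + of_int t * \<i>)"
    unfolding gauss_red_def by blast
  then have "complex_of_int A = of_int (1 + 4 * s) \<and> complex_of_int B = of_int (4 * t)"
    unfolding AB by (simp add: complex_eq_iff)
  then have "A = 1 + 4 * s" "B = 4 * t"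
    by (simp_all only: of_int_eq_iff)
  then have "4 dvd A - 1" "4 dvd B"
    by simp_all
  with AB \<open>A\<^sup>2 + B\<^sup>2 = int p ^ (4 * l)\<close> \<open>\<not> int p dvd A\<close> show ?thesis
    by (intro that[of A B]) (simp_all only: z_def not_False_eq_True)
qed

text \<open>The first conjunct renders "determined by" as an implication: if the base graphs for
  \<open>p\<close> and \<open>r\<close> have equal spectra, so do the graphs at level
  \<open>l\<close>.\<close>

theorem theorem3p6:
  fixes p l :: nat
  assumes "prime p" and "[p = 1] (mod 4)" and "l \<ge> 1"
    and "CARD('a::{field,finite}) = p ^ (4 * l)"
  shows
    "(\<forall>r :: nat.
        prime r \<and> [r = 1] (mod 4)
        \<and> CARD('b::{field,finite}) = p ^ 4
        \<and> CARD('c::{field,finite}) = r ^ 4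
        \<and> CARD('d::{field,finite}) = r ^ (4 * l)
        \<and> graph_spectrum (generalized_paley 4 :: 'b pair_pre_digraph)
            = graph_spectrum (generalized_paley 4 :: 'c pair_pre_digraph)
        \<longrightarrow> graph_spectrum (generalized_paley 4 :: 'a pair_pre_digraph)
            = graph_spectrum (generalized_paley 4 :: 'd pair_pre_digraph))
     \<and>
     (\<forall>c1 d1 :: int.
        (int p)^2 = c1^2 + 4 * d1^2 \<and> [c1 = 1] (mod 4) \<and> gcd c1 (int p) = 1
        \<longrightarrow>
        (let P = (of_nat p :: complex);
             n = (p ^ (4 * l) - 1) div 4;
             c = c_seq c1 d1 l;
             d = d_seq c1 d1 l
         in graph_spectrum (generalized_paley 4 :: 'a pair_pre_digraph) =
              {# of_nat n #}
              + replicate_mset n ((P ^ (2 * l) + 4 * d * P ^ l - 1) / 4)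
              + replicate_mset n ((P ^ (2 * l) - 4 * d * P ^ l - 1) / 4)
              + replicate_mset n ((- (P ^ (2 * l)) + 2 * c * P ^ l - 1) / 4)
              + replicate_mset n ((- (P ^ (2 * l)) - 2 * c * P ^ l - 1) / 4)))"
proof -
  have "odd p"
  proof -
    have "p mod 4 = 1"
      using assms(2) by (simp add: cong_def)
    then show ?thesis
      by presburger
  qed
  have k: "4 * l > 0"
    using assms(3) by simp
  obtain a b :: int and \<gamma> :: complex where ab:
    "a\<^sup>2 + b\<^sup>2 = int p ^ (4 * l)" "\<not> int p dvd a" "4 dvd a + 1" "4 dvd b"
    and \<gamma>: "\<gamma>\<^sup>2 = - of_nat (p ^ (2 * l)) * (of_int a + of_int b * \<i>)"
    and spec: "graph_spectrum (generalized_paley 4 :: 'a pair_pre_digraph)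
       = quartic_spectrum ((p ^ (4 * l) - 1) div 4) (of_nat (p ^ (2 * l))) \<gamma>"
    using spectrum_generalized_paley_4[OF assms] by metis
  show ?thesis
  proof (intro conjI allI impI)
    fix r :: nat
    assume r: "prime r \<and> [r = 1] (mod 4)
        \<and> CARD('b) = p ^ 4 \<and> CARD('c) = r ^ 4 \<and> CARD('d) = r ^ (4 * l)
        \<and> graph_spectrum (generalized_paley 4 :: 'b pair_pre_digraph)
            = graph_spectrum (generalized_paley 4 :: 'c pair_pre_digraph)"
    then have bcd: "CARD('b) = p ^ 4" "CARD('c) = r ^ 4" "CARD('d) = r ^ (4 * l)" "prime r"
      and eq: "graph_spectrum (generalized_paley 4 :: 'b pair_pre_digraph)
            = graph_spectrum (generalized_paley 4 :: 'c pair_pre_digraph)"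
      by simp_all
    have "p ^ 4 = size (graph_spectrum (generalized_paley 4 :: 'b pair_pre_digraph))"
      unfolding generalized_paley_def using size_graph_spectrum_cayley_digraph[OF assms(1) bcd(1)] bcd(1)
      by simp
    also have "\<dots> = r ^ 4"
      unfolding eq unfolding generalized_paley_def
      using size_graph_spectrum_cayley_digraph[OF bcd(4) bcd(2)] bcd(2) by simp
    finally have "p = r"
      by (rule power_eq_imp_eq_base) auto
    then have "CARD('d) = p ^ (4 * l)"
      using bcd(3) by simp
    then obtain a' b' :: int and \<gamma>' :: complex where ab':
      "a'\<^sup>2 + b'\<^sup>2 = int p ^ (4 * l)" "\<not> int p dvd a'" "4 dvd a' + 1" "4 dvd b'"
      and \<gamma>': "\<gamma>'\<^sup>2 = - of_nat (p ^ (2 * l)) * (of_int a' + of_int b' * \<i>)"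
      and spec': "graph_spectrum (generalized_paley 4 :: 'd pair_pre_digraph)
         = quartic_spectrum ((p ^ (4 * l) - 1) div 4) (of_nat (p ^ (2 * l))) \<gamma>'"
      using spectrum_generalized_paley_4[OF assms(1-3), where 'a = 'd] by metis
    have "a' = a \<and> (b' = b \<or> b' = - b)"
      by (rule jacobi_sum_decomposition_unique[OF assms(1) \<open>odd p\<close> k ab ab'])
    then show "graph_spectrum (generalized_paley 4 :: 'a pair_pre_digraph)
        = graph_spectrum (generalized_paley 4 :: 'd pair_pre_digraph)"
      unfolding spec spec' by (rule quartic_spectrum_eqI[OF \<gamma> \<gamma>']) simp
  next
    fix c1 d1 :: int
    assume *: "(int p)^2 = c1^2 + 4 * d1^2 \<and> [c1 = 1] (mod 4) \<and> gcd c1 (int p) = 1"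
    define z :: complex where "z = of_int c1 + 2 * of_int d1 * \<i>"
    obtain A B :: int where z: "z ^ (2 * l) = of_int A + of_int B * \<i>"
      and AB: "A\<^sup>2 + B\<^sup>2 = int p ^ (4 * l)" "\<not> int p dvd A" "4 dvd A - 1" "4 dvd B"
      using gauss_int_powers[OF assms(1) \<open>odd p\<close>, of c1 d1 l] * assms(3) unfolding z_def by metis
    have "4 dvd - A + 1"
      using AB(3) by presburger
    \<comment> \<open>The Jacobi sum is 1 less than a multiple of 4, whereas
      \<open>z ^ (2 * l)\<close> is 1 more; hence the comparison is with the negative of the
      latter.\<close>
    with AB have AB': "- A = a \<and> (- B = b \<or> - B = - b)"
      by (intro jacobi_sum_decomposition_unique[OF assms(1) \<open>odd p\<close> k ab]) simp_all
    define w where "w = z ^ l"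
    \<comment> \<open>\<open>\<delta>\<close> is an explicit square root of
      \<open>- p ^ (2 * l)\<close> times \<open>- z ^ (2 * l)\<close>, so its square agrees with
      that of \<open>\<gamma>\<close> up to conjugation.\<close>
    define \<delta> where "\<delta> = of_nat (p ^ l) * w"
    have "\<delta>\<^sup>2 = of_nat (p ^ (2 * l)) * z ^ (2 * l)"
      by (simp add: \<delta>_def w_def power_mult_distrib mult.commute flip: power_mult)
    also have "\<dots> = - of_nat (p ^ (2 * l)) * (of_int (- A) + of_int (- B) * \<i>)"
      unfolding z by (simp add: algebra_simps)
    finally have \<delta>: "\<delta>\<^sup>2 = - of_nat (p ^ (2 * l)) * (of_int (- A) + of_int (- B) * \<i>)" .
    have spec': "graph_spectrum (generalized_paley 4 :: 'a pair_pre_digraph)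
       = quartic_spectrum ((p ^ (4 * l) - 1) div 4) (of_nat (p ^ (2 * l))) \<delta>"
      unfolding spec by (rule quartic_spectrum_eqI[OF \<gamma> \<delta> AB']) simp
    have w: "(of_int c1 + 2 * of_int d1 * \<i>) ^ l = w"
      and cnj_w: "(of_int c1 - 2 * of_int d1 * \<i>) ^ l = cnj w"
      by (simp_all add: w_def z_def)
    have "c_seq c1 d1 l = of_real (Re w)"
      unfolding c_seq_def w cnj_w by (simp add: complex_eq_iff)
    then have c: "2 * c_seq c1 d1 l * of_nat p ^ l = 2 * of_real (Re \<delta>)"
      by (simp add: \<delta>_def complex_eq_iff flip: of_nat_power)
    have "d_seq c1 d1 l = of_real (Im w) / 2"
      unfolding d_seq_def w cnj_w by (simp add: complex_eq_iff)
    then have d: "4 * d_seq c1 d1 l * of_nat p ^ l = 2 * of_real (Im \<delta>)"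
      by (simp add: \<delta>_def complex_eq_iff flip: of_nat_power)
    show "let P = (of_nat p :: complex);
             n = (p ^ (4 * l) - 1) div 4;
             c = c_seq c1 d1 l;
             d = d_seq c1 d1 l
         in graph_spectrum (generalized_paley 4 :: 'a pair_pre_digraph) =
              {# of_nat n #}
              + replicate_mset n ((P ^ (2 * l) + 4 * d * P ^ l - 1) / 4)
              + replicate_mset n ((P ^ (2 * l) - 4 * d * P ^ l - 1) / 4)
              + replicate_mset n ((- (P ^ (2 * l)) + 2 * c * P ^ l - 1) / 4)
              + replicate_mset n ((- (P ^ (2 * l)) - 2 * c * P ^ l - 1) / 4)"
      unfolding Let_def spec' quartic_spectrum_def c d by (simp only: of_nat_power)
  qed
qed

end
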